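(* The CCV $\lambda\mu$-calculus has the Church–Rosser property: if $M_1=_{ccv}M_2$, then there is a term $N$ with $M_1\to^* N$ and $M_2\to^* N$.
   Context: CCV $\lambda\mu$-calculus. Ordinary variables $x,y,z,\dots$ and continuation variables $k,l,\dots$ form disjoint sets. Terms $M ::= x \mid \lambda x.M \mid MM \mid (M\ \mathsf{where}\ x:=M) \mid \mu k.J$, jumps $J ::= [k]M \mid (J\ \mathsf{where}\ x:=M)$, where $(L\ \mathsf{where}\ x:=M)$ means $\mathsf{let}\ x=M\ \mathsf{in}\ L$; $\lambda x$ binds $x$ in its body, $\mathsf{where}\ x:=M$ binds $x$ in the body $L$ (or $J$) only, $\mu k$ binds $k$. Terms are identified up to $\alpha$-conversion and the congruence generated by (E1) $(L\ \mathsf{where}\ x:=(M\ \mathsf{where}\ y:=N))=((L\ \mathsf{where}\ x:=M)\ \mathsf{where}\ y:=N)$ if $y$ not free in $L$; (E2) $((\mu k.J)\ \mathsf{where}\ x:=M)=\mu k.(J\ \mathsf{where}\ x:=M)$ if $k$ not free in $M$; (E3) $[k](L\ \mathsf{where}\ x:=M)=([k]L\ \mathsf{where}\ x:=M)$. Values $V$: variables and $\lambda$-abstractions; $N$ denotes a non-value. Reduction rules ($z$ fresh): $NM\to(zM\ \mathsf{where}\ z:=N)$; $VN\to(Vz\ \mathsf{where}\ z:=N)$; $(\lambda x.M)V\to(M\ \mathsf{where}\ x:=V)$; $(M\ \mathsf{where}\ x:=V)\to M\{V/x\}$; $(M\ \mathsf{where}\ x:=\mu k.J)\to\mu k.J\{[k]\square\mapsto[k](M\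 \mathsf{where}\ x:=\square)\}$; $[l]\mu k.J\to J\{l/k\}$; $\lambda x.Vx\to V$ ($x$ not free in $V$); $(x\ \mathsf{where}\ x:=M)\to M$; $\mu k.[k]M\to M$ ($k$ not free in $M$). Here $J\{[k]\square\mapsto[k](M\ \mathsf{where}\ x:=\square)\}$ replaces recursively each subjump $[k]Q$ with $k$ free by $[k](M\ \mathsf{where}\ x:=Q)$ (capture-avoiding) and $J\{l/k\}$ replaces each such $[k]Q$ by $[l]Q$. $\to$ is the compatible closure, $\to^*$ its reflexive-transitive closure, and $=_{ccv}$ the smallest congruence containing the rules. *)

theory Defs
  imports Main
begin

text \<open>CCV lambda-mu calculus, with de Bruijn indices (two independent index
spaces: ordinary variables and continuation variables). Alpha-equivalence is
thus syntactic identity. Wh L M = (L where x := M), binding index 0 in L only.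
Mu J binds continuation index 0 in J. Jmp k M = [k]M.\<close>

datatype trm = Var nat | Lam trm | App trm trm | Wh trm trm | Mu jmp
     and jmp = Jmp nat trm | JWh jmp trm

primrec liftT :: "nat \<Rightarrow> trm \<Rightarrow> trm" and liftTj :: "nat \<Rightarrow> jmp \<Rightarrow> jmp" where
  "liftT c (Var i) = Var (if c \<le> i then Suc i else i)"
| "liftT c (Lam t) = Lam (liftT (Suc c) t)"
| "liftT c (App s t) = App (liftT c s) (liftT c t)"
| "liftT c (Wh s t) = Wh (liftT (Suc c) s) (liftT c t)"
| "liftT c (Mu j) = Mu (liftTj c j)"
| "liftTj c (Jmp k t) = Jmp k (liftT c t)"
| "liftTj c (JWh j t) = JWh (liftTj (Suc c) j) (liftT c t)"

primrec liftK :: "nat \<Rightarrow> trm \<Rightarrow> trm" and liftKj :: "nat \<Rightarrow> jmp \<Rightarrow> jmp" where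
  "liftK c (Var i) = Var i"
| "liftK c (Lam t) = Lam (liftK c t)"
| "liftK c (App s t) = App (liftK c s) (liftK c t)"
| "liftK c (Wh s t) = Wh (liftK c s) (liftK c t)"
| "liftK c (Mu j) = Mu (liftKj (Suc c) j)"
| "liftKj c (Jmp k t) = Jmp (if c \<le> k then Suc k else k) (liftK c t)"
| "liftKj c (JWh j t) = JWh (liftKj c j) (liftK c t)"

primrec substT :: "nat \<Rightarrow> trm \<Rightarrow> trm \<Rightarrow> trm" and substTj :: "nat \<Rightarrow> trm \<Rightarrow> jmp \<Rightarrow> jmp" where
  "substT n V (Var i) = (if i = n then V else if n < i then Var (i - 1) else Var i)"
| "substT n V (Lam t) = Lam (substT (Suc n) (liftT 0 V) t)"
| "substT n V (App s t) = App (substT n V s) (substT n V t)"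
| "substT n V (Wh s t) = Wh (substT (Suc n) (liftT 0 V) s) (substT n V t)"
| "substT n V (Mu j) = Mu (substTj n (liftK 0 V) j)"
| "substTj n V (Jmp k t) = Jmp k (substT n V t)"
| "substTj n V (JWh j t) = JWh (substTj (Suc n) (liftT 0 V) j) (substT n V t)"

text \<open>Structural substitution J{[k]\<box> \<mapsto> [k](M where x := \<box>)} for continuation
index c; in M, ordinary index 0 is the locally bound x.\<close>
primrec sst :: "nat \<Rightarrow> trm \<Rightarrow> trm \<Rightarrow> trm" and sstj :: "nat \<Rightarrow> trm \<Rightarrow> jmp \<Rightarrow> jmp" where
  "sst c M (Var i) = Var i"
| "sst c M (Lam t) = Lam (sst c (liftT 1 M) t)"
| "sst c M (App s t) = App (sst c M s) (sst c M t)"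
| "sst c M (Wh s t) = Wh (sst c (liftT 1 M) s) (sst c M t)"
| "sst c M (Mu j) = Mu (sstj (Suc c) (liftK 0 M) j)"
| "sstj c M (Jmp k t) = (if k = c then Jmp k (Wh M (sst c M t)) else Jmp k (sst c M t))"
| "sstj c M (JWh j t) = JWh (sstj c (liftT 1 M) j) (sst c M t)"

primrec renK :: "nat \<Rightarrow> nat \<Rightarrow> trm \<Rightarrow> trm" and renKj :: "nat \<Rightarrow> nat \<Rightarrow> jmp \<Rightarrow> jmp" where
  "renK c l (Var i) = Var i"
| "renK c l (Lam t) = Lam (renK c l t)"
| "renK c l (App s t) = App (renK c l s) (renK c l t)"
| "renK c l (Wh s t) = Wh (renK c l s) (renK c l t)"
| "renK c l (Mu j) = Mu (renKj (Suc c) (Suc l) j)"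
| "renKj c l (Jmp k t) = Jmp (if k = c then l else if c < k then k - 1 else k) (renK c l t)"
| "renKj c l (JWh j t) = JWh (renKj c l j) (renK c l t)"

fun is_val :: "trm \<Rightarrow> bool" where
  "is_val (Var _) = True"
| "is_val (Lam _) = True"
| "is_val _ = False"

text \<open>The structural congruence generated by (E1), (E2), (E3).
Side conditions "y not free in L" of (E1) is automatic with de Bruijn indices;
"k not free in M" of (E2) is expressed by M being lifted.\<close>
inductive eqT :: "trm \<Rightarrow> trm \<Rightarrow> bool" and eqJ :: "jmp \<Rightarrow> jmp \<Rightarrow> bool" where
  E1: "eqT (Wh L (Wh M N)) (Wh (Wh (liftT 1 L) M) N)"
| E1j: "eqJ (JWh J (Wh M N)) (JWh (JWh (liftTj 1 J) M) N)"
| E2: "eqT (Wh (Mu J) M) (Mu (JWh J (liftK 0 M)))"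
| E3: "eqJ (Jmp k (Wh L M)) (JWh (Jmp k L) M)"
| reflT: "eqT t t"
| symT: "eqT s t \<Longrightarrow> eqT t s"
| transT: "eqT s t \<Longrightarrow> eqT t u \<Longrightarrow> eqT s u"
| reflJ: "eqJ j j"
| symJ: "eqJ i j \<Longrightarrow> eqJ j i"
| transJ: "eqJ i j \<Longrightarrow> eqJ j h \<Longrightarrow> eqJ i h"
| cLam: "eqT s t \<Longrightarrow> eqT (Lam s) (Lam t)"
| cApp: "eqT s s' \<Longrightarrow> eqT t t' \<Longrightarrow> eqT (App s t) (App s' t')"
| cWh: "eqT s s' \<Longrightarrow> eqT t t' \<Longrightarrow> eqT (Wh s t) (Wh s' t')"
| cMu: "eqJ i j \<Longrightarrow> eqT (Mu i) (Mu j)"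
| cJmp: "eqT s t \<Longrightarrow> eqJ (Jmp k s) (Jmp k t)"
| cJWh: "eqJ i j \<Longrightarrow> eqT t t' \<Longrightarrow> eqJ (JWh i t) (JWh j t')"

inductive redT :: "trm \<Rightarrow> trm \<Rightarrow> bool" and redJ :: "jmp \<Rightarrow> jmp \<Rightarrow> bool" where
  r_nv1: "\<not> is_val N \<Longrightarrow> redT (App N M) (Wh (App (Var 0) (liftT 0 M)) N)"
| r_nv2: "is_val V \<Longrightarrow> \<not> is_val N \<Longrightarrow> redT (App V N) (Wh (App (liftT 0 V) (Var 0)) N)"
| r_beta: "is_val V \<Longrightarrow> redT (App (Lam M) V) (Wh M V)"
| r_sub: "is_val V \<Longrightarrow> redT (Wh M V) (substT 0 V M)"
| r_mu: "redT (Wh M (Mu J)) (Mu (sstj 0 (liftK 0 M) J))"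
| r_ren: "redJ (Jmp l (Mu J)) (renKj 0 l J)"
| r_eta: "is_val V \<Longrightarrow> redT (Lam (App (liftT 0 V) (Var 0))) V"
| r_var: "redT (Wh (Var 0) M) M"
| r_muk: "redT (Mu (Jmp 0 (liftK 0 M))) M"
| rLam: "redT s t \<Longrightarrow> redT (Lam s) (Lam t)"
| rApp1: "redT s s' \<Longrightarrow> redT (App s t) (App s' t)"
| rApp2: "redT t t' \<Longrightarrow> redT (App s t) (App s t')"
| rWh1: "redT s s' \<Longrightarrow> redT (Wh s t) (Wh s' t)"
| rWh2: "redT t t' \<Longrightarrow> redT (Wh s t) (Wh s t')"
| rMu: "redJ i j \<Longrightarrow> redT (Mu i) (Mu j)"
| rJmp: "redT s t \<Longrightarrow> redJ (Jmp k s) (Jmp k t)"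
| rJWh1: "redJ i j \<Longrightarrow> redJ (JWh i t) (JWh j t)"
| rJWh2: "redT t t' \<Longrightarrow> redJ (JWh i t) (JWh i t')"

text \<open>M \<rightarrow>* N on terms modulo the congruence: reflexive-transitive closure of
one-step reduction together with the identification eqT.\<close>
definition reds :: "trm \<Rightarrow> trm \<Rightarrow> bool" where
  "reds = (\<lambda>a b. eqT a b \<or> redT a b)\<^sup>*\<^sup>*"

definition ccv_eq :: "trm \<Rightarrow> trm \<Rightarrow> bool" where
  "ccv_eq = (\<lambda>a b. eqT a b \<or> redT a b \<or> redT b a)\<^sup>*\<^sup>*"

end

theory Submission
  imports Defs
begin

text \<open>
The proof is a reflection argument. A one-pass call-by-value CPS translation \<open>M : K\<close> identifies
(E1)-(E3)-equal terms and maps every reduction rule to a conversion of a small CPS calculus with beta and eta rules,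
whose parallel reduction has the diamond property. A readback from that calculus to source terms
simulates each parallel reduction by \<open>reds\<close>, and every term reduces to the readback of its own
translation. So a common reduct of the translations of \<open>M1\<close> and \<open>M2\<close> is read back as a common
reduct of \<open>M1\<close> and \<open>M2\<close>. The delicate point is that \<open>L where x := M\<close> does not reduce to
\<open>\<mu>k.[k](L where x := M)\<close>: the readback must contract such \<open>\<mu>\<close>-eta redexes itself, which it does
whenever the continuation variable is used exactly once and in tail position.
\<close>

text \<open>The target cannot tell \<open>M\<close> from \<open>\<mu>k.[k]M\<close>, while the
  source contracts the second to the first and not back; so the readback has to produce the
  contracted form. Whether a \<mu> is contracted is not stable under target reduction. A call to a
  function that drops or copies its continuation can make a linear command nonlinear: a \<mu> then
  appears below a spine of \<open>where\<close>s and is brought outside by (E2) or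
  \<open>r_mu\<close>. Conversely, erasing an argument that mentions the continuation can make a
  nonlinear command linear: then \<open>r_muk\<close> is applied. For this reason the simulation
  carries two statements side by side, one for commands read as jumps and one for linear commands
  read as terms without \<mu>.\<close>

definition scons :: "'a \<Rightarrow> (nat \<Rightarrow> 'a) \<Rightarrow> nat \<Rightarrow> 'a" (infixr "\<cdot>" 70) where
  "a \<cdot> f = (\<lambda>n. case n of 0 \<Rightarrow> a | Suc m \<Rightarrow> f m)"

lemma scons_simps [simp]: "(a \<cdot> f) 0 = a" "(a \<cdot> f) (Suc n) = f n"
  by (simp_all add: scons_def)

lemma comp_scons: "(\<lambda>n. g ((a \<cdot> f) n)) = g a \<cdot> (\<lambda>n. g (f n))"
  by (rule ext) (simp add: scons_def split: nat.split)

lemma scons_eqI: "a = g 0 \<Longrightarrow> (\<And>n. f n = g (Suc n)) \<Longrightarrow> a \<cdot> f = g"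
  by (rule ext) (simp add: scons_def split: nat.split)

section \<open>The target calculus\<close>

text \<open>Commands of continuation-passing style. \<open>VL Q\<close> is \<open>\<lambda>x k. Q\<close> and binds index 0 of both index
spaces, \<open>KL Q\<close> is the continuation \<open>\<lambda>x. Q\<close>; \<open>Ret K W\<close> passes \<open>W\<close> to \<open>K\<close>, and
\<open>Cal V W K\<close> calls \<open>V\<close> with argument \<open>W\<close> and continuation \<open>K\<close>.\<close>

datatype val = VV nat | VL cmd
     and cmd = Ret kon val | Cal val val kon
     and kon = KV nat | KL cmd

definition up :: "(nat \<Rightarrow> nat) \<Rightarrow> nat \<Rightarrow> nat" where
  "up r = 0 \<cdot> (\<lambda>i. Suc (r i))"

primrec rnV :: "(nat \<Rightarrow> nat) \<Rightarrow> (nat \<Rightarrow> nat) \<Rightarrow> val \<Rightarrow> val"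
    and rnQ :: "(nat \<Rightarrow> nat) \<Rightarrow> (nat \<Rightarrow> nat) \<Rightarrow> cmd \<Rightarrow> cmd"
    and rnK :: "(nat \<Rightarrow> nat) \<Rightarrow> (nat \<Rightarrow> nat) \<Rightarrow> kon \<Rightarrow> kon" where
  "rnV r c (VV i) = VV (r i)"
| "rnV r c (VL Q) = VL (rnQ (up r) (up c) Q)"
| "rnQ r c (Ret K W) = Ret (rnK r c K) (rnV r c W)"
| "rnQ r c (Cal V W K) = Cal (rnV r c V) (rnV r c W) (rnK r c K)"
| "rnK r c (KV k) = KV (c k)"
| "rnK r c (KL Q) = KL (rnQ (up r) c Q)"

abbreviation "shV \<equiv> rnV Suc (\<lambda>k. k)"
abbreviation "shK \<equiv> rnK Suc (\<lambda>k. k)"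
abbreviation "sh2V \<equiv> rnV Suc Suc"
abbreviation "sh2K \<equiv> rnK Suc Suc"

text \<open>Environments are pushed under \<open>KL\<close> by \<open>xV\<close> and \<open>shK\<close>, and under \<open>VL\<close> by \<open>lV\<close> and \<open>lK\<close>.\<close>

definition xV :: "(nat \<Rightarrow> val) \<Rightarrow> nat \<Rightarrow> val" where "xV s = VV 0 \<cdot> (\<lambda>i. shV (s i))"
definition lV :: "(nat \<Rightarrow> val) \<Rightarrow> nat \<Rightarrow> val" where "lV s = VV 0 \<cdot> (\<lambda>i. sh2V (s i))"
definition lK :: "(nat \<Rightarrow> kon) \<Rightarrow> nat \<Rightarrow> kon" where "lK t = KV 0 \<cdot> (\<lambda>i. sh2K (t i))"

text \<open>Substitution is simultaneous, with total functions as environments for both index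
  spaces. Its composition laws then reduce to pointwise equations between environments, without the
  index arithmetic of the source operations.\<close>

primrec sbV :: "(nat \<Rightarrow> val) \<Rightarrow> (nat \<Rightarrow> kon) \<Rightarrow> val \<Rightarrow> val"
    and sbQ :: "(nat \<Rightarrow> val) \<Rightarrow> (nat \<Rightarrow> kon) \<Rightarrow> cmd \<Rightarrow> cmd"
    and sbK :: "(nat \<Rightarrow> val) \<Rightarrow> (nat \<Rightarrow> kon) \<Rightarrow> kon \<Rightarrow> kon" where
  "sbV s t (VV i) = s i"
| "sbV s t (VL Q) = VL (sbQ (lV s) (lK t) Q)"
| "sbQ s t (Ret K W) = Ret (sbK s t K) (sbV s t W)"
| "sbQ s t (Cal V W K) = Cal (sbV s t V) (sbV s t W) (sbK s t K)"
| "sbK s t (KV k) = t k"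
| "sbK s t (KL Q) = KL (sbQ (xV s) (\<lambda>k. shK (t k)) Q)"

abbreviation inst1 :: "val \<Rightarrow> cmd \<Rightarrow> cmd" where "inst1 W \<equiv> sbQ (W \<cdot> VV) KV"
abbreviation inst2 :: "val \<Rightarrow> kon \<Rightarrow> cmd \<Rightarrow> cmd" where "inst2 W K \<equiv> sbQ (W \<cdot> VV) (K \<cdot> KV)"

section \<open>Laws of simultaneous renaming and substitution\<close>

lemma up_simps [simp]: "up r 0 = 0" "up r (Suc i) = Suc (r i)"
  by (simp_all add: up_def)

lemma up_up: "(\<lambda>i. up r (up r' i)) = up (\<lambda>i. r (r' i))"
  unfolding up_def comp_scons by simp

lemma up_id [simp]: "up (\<lambda>i. i) = (\<lambda>i. i)"
  unfolding up_def by (rule scons_eqI) simp_all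

lemma rn_rn:
  "rnV r c (rnV r' c' v) = rnV (\<lambda>i. r (r' i)) (\<lambda>k. c (c' k)) v"
  "rnQ r c (rnQ r' c' q) = rnQ (\<lambda>i. r (r' i)) (\<lambda>k. c (c' k)) q"
  "rnK r c (rnK r' c' k) = rnK (\<lambda>i. r (r' i)) (\<lambda>k. c (c' k)) k"
  by (induct v and q and k arbitrary: r c r' c' and r c r' c' and r c r' c')
     (simp_all add: up_up)

lemma rn_id [simp]:
  "rnV (\<lambda>i. i) (\<lambda>k. k) v = v" "rnQ (\<lambda>i. i) (\<lambda>k. k) q = q" "rnK (\<lambda>i. i) (\<lambda>k. k) k = k"
  by (induct v and q and k) simp_all

lemma env_up:
  "(\<lambda>i. xV s (up r i)) = xV (\<lambda>i. s (r i))"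
  "(\<lambda>i. lV s (up r i)) = lV (\<lambda>i. s (r i))"
  "(\<lambda>i. lK t (up c i)) = lK (\<lambda>i. t (c i))"
  unfolding xV_def lV_def lK_def up_def by (simp_all add: comp_scons)

lemma sb_rn:
  "sbV s t (rnV r c v) = sbV (\<lambda>i. s (r i)) (\<lambda>k. t (c k)) v"
  "sbQ s t (rnQ r c q) = sbQ (\<lambda>i. s (r i)) (\<lambda>k. t (c k)) q"
  "sbK s t (rnK r c k) = sbK (\<lambda>i. s (r i)) (\<lambda>k. t (c k)) k"
  by (induct v and q and k arbitrary: s t r c and s t r c and s t r c)
     (simp_all add: env_up)

lemma rn_env:
  "(\<lambda>i. rnV (up r) c (xV s i)) = xV (\<lambda>i. rnV r c (s i))"
  "(\<lambda>i. rnV (up r) (up c) (lV s i)) = lV (\<lambda>i. rnV r c (s i))"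
  "(\<lambda>i. rnK (up r) (up c) (lK t i)) = lK (\<lambda>i. rnK r c (t i))"
  unfolding xV_def lV_def lK_def by (simp_all add: comp_scons rn_rn)

lemma rn_sb:
  "rnV r c (sbV s t v) = sbV (\<lambda>i. rnV r c (s i)) (\<lambda>k. rnK r c (t k)) v"
  "rnQ r c (sbQ s t q) = sbQ (\<lambda>i. rnV r c (s i)) (\<lambda>k. rnK r c (t k)) q"
  "rnK r c (sbK s t k) = sbK (\<lambda>i. rnV r c (s i)) (\<lambda>k. rnK r c (t k)) k"
  by (induct v and q and k arbitrary: s t r c and s t r c and s t r c)
     (simp_all add: rn_env rn_rn)

lemma sb_env:
  "(\<lambda>i. sbV (xV s) (\<lambda>k. shK (t k)) (xV s' i)) = xV (\<lambda>i. sbV s t (s' i))"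
  "(\<lambda>i. sbV (lV s) (lK t) (lV s' i)) = lV (\<lambda>i. sbV s t (s' i))"
  "(\<lambda>i. sbK (lV s) (lK t) (lK t' i)) = lK (\<lambda>i. sbK s t (t' i))"
  unfolding xV_def lV_def lK_def by (simp_all add: comp_scons rn_sb sb_rn)

lemma sb_sb:
  "sbV s t (sbV s' t' v) = sbV (\<lambda>i. sbV s t (s' i)) (\<lambda>k. sbK s t (t' k)) v"
  "sbQ s t (sbQ s' t' q) = sbQ (\<lambda>i. sbV s t (s' i)) (\<lambda>k. sbK s t (t' k)) q"
  "sbK s t (sbK s' t' k) = sbK (\<lambda>i. sbV s t (s' i)) (\<lambda>k. sbK s t (t' k)) k"
  by (induct v and q and k arbitrary: s t s' t' and s t s' t' and s t s' t')
     (simp_all add: sb_env rn_sb sb_rn, simp_all add: xV_def)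

lemma env_id [simp]: "xV VV = VV" "lV VV = VV" "lK KV = KV"
  unfolding xV_def lV_def lK_def by (rule scons_eqI; simp)+

lemma sb_id [simp]: "sbV VV KV v = v" "sbQ VV KV q = q" "sbK VV KV k = k"
  by (induct v and q and k) simp_all

text \<open>\<open>ocx\<close> and \<open>ock\<close>: free occurrence of an ordinary and of a continuation variable.\<close>

primrec ocxV :: "nat \<Rightarrow> val \<Rightarrow> bool" and ocxQ :: "nat \<Rightarrow> cmd \<Rightarrow> bool"
    and ocxK :: "nat \<Rightarrow> kon \<Rightarrow> bool" where
  "ocxV n (VV i) = (i = n)"
| "ocxV n (VL Q) = ocxQ (Suc n) Q"
| "ocxQ n (Ret K W) = (ocxK n K \<or> ocxV n W)"
| "ocxQ n (Cal V W K) = (ocxV n V \<or> ocxV n W \<or> ocxK n K)"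
| "ocxK n (KV k) = False"
| "ocxK n (KL Q) = ocxQ (Suc n) Q"

primrec ockV :: "nat \<Rightarrow> val \<Rightarrow> bool" and ockQ :: "nat \<Rightarrow> cmd \<Rightarrow> bool"
    and ockK :: "nat \<Rightarrow> kon \<Rightarrow> bool" where
  "ockV n (VV i) = False"
| "ockV n (VL Q) = ockQ (Suc n) Q"
| "ockQ n (Ret K W) = (ockK n K \<or> ockV n W)"
| "ockQ n (Cal V W K) = (ockV n V \<or> ockV n W \<or> ockK n K)"
| "ockK n (KV k) = (k = n)"
| "ockK n (KL Q) = ockQ n Q"

lemma env_agree:
  "(\<And>i. P (Suc i) \<Longrightarrow> s i = s' i) \<Longrightarrow> P i \<Longrightarrow> xV s i = xV s' i"
  "(\<And>i. P (Suc i) \<Longrightarrow> s i = s' i) \<Longrightarrow> P i \<Longrightarrow> lV s i = lV s' i"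
  "(\<And>i. P (Suc i) \<Longrightarrow> t i = t' i) \<Longrightarrow> P i \<Longrightarrow> lK t i = lK t' i"
  by (cases i; simp add: xV_def lV_def lK_def)+

text \<open>The purpose is strengthening: if index 0 does not occur, lowering all indices and
  raising them again acts as the identity. \<open>p_sh2V_inv\<close> and \<open>p_shK_inv\<close>
  use it in this way.\<close>

lemma sb_cong:
  "(\<And>i. ocxV i v \<Longrightarrow> s i = s' i) \<Longrightarrow> (\<And>k. ockV k v \<Longrightarrow> t k = t' k) \<Longrightarrow> sbV s t v = sbV s' t' v"
  "(\<And>i. ocxQ i q \<Longrightarrow> s i = s' i) \<Longrightarrow> (\<And>k. ockQ k q \<Longrightarrow> t k = t' k) \<Longrightarrow> sbQ s t q = sbQ s' t' q"
  "(\<And>i. ocxK i k \<Longrightarrow> s i = s' i) \<Longrightarrow> (\<And>l. ockK l k \<Longrightarrow> t l = t' l) \<Longrightarrow> sbK s t k = sbK s' t' k"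
proof (induct v and q and k arbitrary: s t s' t' and s t s' t' and s t s' t')
  case (VL q)
  show ?case
    using VL.prems by (simp, intro VL.hyps) (auto intro: env_agree(2,3)[where P="\<lambda>i. ocxQ i q"] env_agree(3)[where P="\<lambda>i. ockQ i q"])
next
  case (KL q)
  show ?case
    using KL.prems by (simp, intro KL.hyps) (auto intro: env_agree(1)[where P="\<lambda>i. ocxQ i q"])
next
  case (Ret k v)
  show ?case by (simp, intro conjI Ret.hyps; simp add: Ret.prems)
next
  case (Cal v w k)
  show ?case by (simp, intro conjI Cal.hyps; simp add: Cal.prems)
qed simp_all

lemma ex_nat_split: "(\<exists>i. P i) \<longleftrightarrow> P 0 \<or> (\<exists>i. P (Suc i))"
  by (metis nat.exhaust)

lemma ex_up: "(\<exists>i. P i \<and> Suc n = up r i) \<longleftrightarrow> (\<exists>i. P (Suc i) \<and> n = r i)"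
proof
  assume "\<exists>i. P i \<and> Suc n = up r i"
  then obtain i where "P i" "Suc n = up r i" by blast
  then show "\<exists>i. P (Suc i) \<and> n = r i" by (cases i) auto
qed (metis up_simps(2))

lemma ocx_rn:
  "ocxV n (rnV r c v) \<longleftrightarrow> (\<exists>i. ocxV i v \<and> n = r i)"
  "ocxQ n (rnQ r c q) \<longleftrightarrow> (\<exists>i. ocxQ i q \<and> n = r i)"
  "ocxK n (rnK r c k) \<longleftrightarrow> (\<exists>i. ocxK i k \<and> n = r i)"
by (induct v and q and k arbitrary: n r c and n r c and n r c) (auto simp: ex_up)

lemma ock_rn:
  "ockV n (rnV r c v) \<longleftrightarrow> (\<exists>i. ockV i v \<and> n = c i)"
  "ockQ n (rnQ r c q) \<longleftrightarrow> (\<exists>i. ockQ i q \<and> n = c i)"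
  "ockK n (rnK r c k) \<longleftrightarrow> (\<exists>i. ockK i k \<and> n = c i)"
by (induct v and q and k arbitrary: n r c and n r c and n r c) (auto simp: ex_up)

lemma ocx_sb:
  "ocxV n (sbV s t v) \<Longrightarrow> (\<exists>i. ocxV i v \<and> ocxV n (s i)) \<or> (\<exists>k. ockV k v \<and> ocxK n (t k))"
  "ocxQ n (sbQ s t q) \<Longrightarrow> (\<exists>i. ocxQ i q \<and> ocxV n (s i)) \<or> (\<exists>k. ockQ k q \<and> ocxK n (t k))"
  "ocxK n (sbK s t k) \<Longrightarrow> (\<exists>i. ocxK i k \<and> ocxV n (s i)) \<or> (\<exists>l. ockK l k \<and> ocxK n (t l))"
proof (induct v and q and k arbitrary: n s t and n s t and n s t)
  case (VL q)
  from VL.prems have "ocxQ (Suc n) (sbQ (lV s) (lK t) q)" by simp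
  from VL.hyps[OF this] show ?case
  proof
    assume "\<exists>i. ocxQ i q \<and> ocxV (Suc n) (lV s i)"
    then obtain i where i: "ocxQ i q" "ocxV (Suc n) (lV s i)" by blast
    then show ?thesis by (cases i) (auto simp: lV_def ocx_rn)
  next
    assume "\<exists>k. ockQ k q \<and> ocxK (Suc n) (lK t k)"
    then obtain k where k: "ockQ k q" "ocxK (Suc n) (lK t k)" by blast
    then show ?thesis by (cases k) (auto simp: lK_def ocx_rn)
  qed
next
  case (KL q)
  from KL.prems have "ocxQ (Suc n) (sbQ (xV s) (\<lambda>k. shK (t k)) q)" by simp
  from KL.hyps[OF this] show ?case
  proof
    assume "\<exists>i. ocxQ i q \<and> ocxV (Suc n) (xV s i)"
    then obtain i where i: "ocxQ i q" "ocxV (Suc n) (xV s i)" by blast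
    then show ?thesis by (cases i) (auto simp: xV_def ocx_rn)
  qed (auto simp: ocx_rn)
next
  case (Ret k v)
  from Ret.prems show ?case by (auto dest!: Ret.hyps)
next
  case (Cal v w k)
  from Cal.prems show ?case by (auto dest!: Cal.hyps)
qed auto

lemma ock_sb:
  "ockV n (sbV s t v) \<Longrightarrow> (\<exists>i. ocxV i v \<and> ockV n (s i)) \<or> (\<exists>k. ockV k v \<and> ockK n (t k))"
  "ockQ n (sbQ s t q) \<Longrightarrow> (\<exists>i. ocxQ i q \<and> ockV n (s i)) \<or> (\<exists>k. ockQ k q \<and> ockK n (t k))"
  "ockK n (sbK s t k) \<Longrightarrow> (\<exists>i. ocxK i k \<and> ockV n (s i)) \<or> (\<exists>l. ockK l k \<and> ockK n (t l))"
proof (induct v and q and k arbitrary: n s t and n s t and n s t)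
  case (VL q)
  from VL.prems have "ockQ (Suc n) (sbQ (lV s) (lK t) q)" by simp
  from VL.hyps[OF this] show ?case
  proof
    assume "\<exists>i. ocxQ i q \<and> ockV (Suc n) (lV s i)"
    then obtain i where i: "ocxQ i q" "ockV (Suc n) (lV s i)" by blast
    then show ?thesis by (cases i) (auto simp: lV_def ock_rn)
  next
    assume "\<exists>k. ockQ k q \<and> ockK (Suc n) (lK t k)"
    then obtain k where k: "ockQ k q" "ockK (Suc n) (lK t k)" by blast
    then show ?thesis by (cases k) (auto simp: lK_def ock_rn)
  qed
next
  case (KL q)
  from KL.prems have "ockQ n (sbQ (xV s) (\<lambda>k. shK (t k)) q)" by simp
  from KL.hyps[OF this] show ?case
  proof
    assume "\<exists>i. ocxQ i q \<and> ockV n (xV s i)"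
    then obtain i where i: "ocxQ i q" "ockV n (xV s i)" by blast
    then show ?thesis by (cases i) (auto simp: xV_def ock_rn)
  qed (auto simp: ock_rn)
next
  case (Ret k v)
  from Ret.prems show ?case by (auto dest!: Ret.hyps)
next
  case (Cal v w k)
  from Cal.prems show ?case by (auto dest!: Cal.hyps)
qed auto

section \<open>Confluence of the target calculus\<close>

text \<open>Parallel reduction in the style of Tait and Martin-Loef. The eta rules
  \<open>pVeta\<close> and \<open>pKeta\<close> answer to the source rules \<open>r_eta\<close> and
  \<open>r_var\<close>, the beta rules \<open>pRetb\<close> and \<open>pCalb\<close> to
  \<open>r_sub\<close> and \<open>r_beta\<close>.\<close>

inductive pV :: "val \<Rightarrow> val \<Rightarrow> bool" and pQ :: "cmd \<Rightarrow> cmd \<Rightarrow> bool" and pK :: "kon \<Rightarrow> kon \<Rightarrow> bool" where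
  pVV: "pV (VV i) (VV i)"
| pVL: "pQ Q Q' \<Longrightarrow> pV (VL Q) (VL Q')"
| pVeta: "pV W W' \<Longrightarrow> pV (VL (Cal (sh2V W) (VV 0) (KV 0))) W'"
| pRet: "pK K K' \<Longrightarrow> pV W W' \<Longrightarrow> pQ (Ret K W) (Ret K' W')"
| pRetb: "pQ Q Q' \<Longrightarrow> pV W W' \<Longrightarrow> pQ (Ret (KL Q) W) (inst1 W' Q')"
| pCal: "pV V V' \<Longrightarrow> pV W W' \<Longrightarrow> pK K K' \<Longrightarrow> pQ (Cal V W K) (Cal V' W' K')"
| pCalb: "pQ Q Q' \<Longrightarrow> pV W W' \<Longrightarrow> pK K K' \<Longrightarrow> pQ (Cal (VL Q) W K) (inst2 W' K' Q')"
| pKV: "pK (KV k) (KV k)"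
| pKL: "pQ Q Q' \<Longrightarrow> pK (KL Q) (KL Q')"
| pKeta: "pK K K' \<Longrightarrow> pK (KL (Ret (shK K) (VV 0))) K'"

lemma p_refl [simp, intro]: "pV v v" "pQ q q" "pK k k"
  by (induct v and q and k) (auto intro: pV_pQ_pK.intros)

lemma inst_rn:
  "rnQ r c (inst1 W Q) = inst1 (rnV r c W) (rnQ (up r) c Q)"
  "rnQ r c (inst2 W K Q) = inst2 (rnV r c W) (rnK r c K) (rnQ (up r) (up c) Q)"
  by (simp_all add: rn_sb sb_rn comp_scons up_def)

lemma sb_shift:
  "sbV (xV s) (\<lambda>k. shK (t k)) (shV v) = shV (sbV s t v)"
  "sbK (xV s) (\<lambda>k. shK (t k)) (shK k) = shK (sbK s t k)"
  "sbV (lV s) (lK t) (sh2V v) = sh2V (sbV s t v)"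
  by (simp_all add: rn_sb sb_rn xV_def lV_def lK_def)

lemma inst_sb:
  "sbQ s t (inst1 W Q) = inst1 (sbV s t W) (sbQ (xV s) (\<lambda>k. shK (t k)) Q)"
  "sbQ s t (inst2 W K Q) = inst2 (sbV s t W) (sbK s t K) (sbQ (lV s) (lK t) Q)"
  by (simp_all add: sb_sb sb_rn comp_scons xV_def lV_def lK_def)

lemma p_rn:
  "pV v v' \<Longrightarrow> pV (rnV r c v) (rnV r c v')"
  "pQ q q' \<Longrightarrow> pQ (rnQ r c q) (rnQ r c q')"
  "pK k k' \<Longrightarrow> pK (rnK r c k) (rnK r c k')"
proof (induct arbitrary: r c and r c and r c rule: pV_pQ_pK.inducts)
  case (pVeta W W')
  have "rnV (up r) (up c) (sh2V W) = sh2V (rnV r c W)" by (simp add: rn_rn)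
  with pVeta show ?case by (simp add: pV_pQ_pK.pVeta)
next
  case (pKeta K K')
  have "rnK (up r) c (shK K) = shK (rnK r c K)" by (simp add: rn_rn)
  with pKeta show ?case by (simp add: pV_pQ_pK.pKeta)
qed (auto simp: inst_rn intro: pV_pQ_pK.intros)

lemma p_env:
  "(\<And>i. pV (s i) (s' i)) \<Longrightarrow> pV (xV s i) (xV s' i)"
  "(\<And>i. pV (s i) (s' i)) \<Longrightarrow> pV (lV s i) (lV s' i)"
  "(\<And>i. pK (t i) (t' i)) \<Longrightarrow> pK (lK t i) (lK t' i)"
  by (cases i; simp add: xV_def lV_def lK_def p_rn)+

lemma p_sb:
  "pV v v' \<Longrightarrow> (\<And>i. pV (s i) (s' i)) \<Longrightarrow> (\<And>l. pK (t l) (t' l)) \<Longrightarrow> pV (sbV s t v) (sbV s' t' v')"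
  "pQ q q' \<Longrightarrow> (\<And>i. pV (s i) (s' i)) \<Longrightarrow> (\<And>l. pK (t l) (t' l)) \<Longrightarrow> pQ (sbQ s t q) (sbQ s' t' q')"
  "pK k k' \<Longrightarrow> (\<And>i. pV (s i) (s' i)) \<Longrightarrow> (\<And>l. pK (t l) (t' l)) \<Longrightarrow> pK (sbK s t k) (sbK s' t' k')"
proof (induct arbitrary: s s' t t' and s s' t t' and s s' t t' rule: pV_pQ_pK.inducts)
  case (pVeta W W')
  have "lV s 0 = VV 0" "lK t 0 = KV 0" by (simp_all add: lV_def lK_def)
  with pVeta show ?case by (simp add: pV_pQ_pK.pVeta sb_shift)
next
  case (pKeta K K')
  have "xV s 0 = VV 0" by (simp add: xV_def)
  with pKeta show ?case by (simp add: pV_pQ_pK.pKeta sb_shift)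
qed (auto simp: inst_sb p_env p_rn intro!: pV_pQ_pK.intros)

lemma p_inst:
  "pQ Q Q' \<Longrightarrow> pV W W' \<Longrightarrow> pQ (inst1 W Q) (inst1 W' Q')"
  "pQ Q Q' \<Longrightarrow> pV W W' \<Longrightarrow> pK K K' \<Longrightarrow> pQ (inst2 W K Q) (inst2 W' K' Q')"
  by (rule p_sb; simp add: scons_def split: nat.split)+

lemma ex_scons:
  "(\<exists>i. P i \<and> ocxV n ((a \<cdot> f) i)) \<longleftrightarrow> P 0 \<and> ocxV n a \<or> (\<exists>i. P (Suc i) \<and> ocxV n (f i))"
  "(\<exists>i. P i \<and> ockV n ((a \<cdot> f) i)) \<longleftrightarrow> P 0 \<and> ockV n a \<or> (\<exists>i. P (Suc i) \<and> ockV n (f i))"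
  "(\<exists>i. P i \<and> ocxK n ((b \<cdot> g) i)) \<longleftrightarrow> P 0 \<and> ocxK n b \<or> (\<exists>i. P (Suc i) \<and> ocxK n (g i))"
  "(\<exists>i. P i \<and> ockK n ((b \<cdot> g) i)) \<longleftrightarrow> P 0 \<and> ockK n b \<or> (\<exists>i. P (Suc i) \<and> ockK n (g i))"
  by (subst ex_nat_split; simp)+

text \<open>Used for two purposes: to invert a reduction out of a shifted term, which is what an eta
  redex contains, and in the simulation to know that reduced arguments still avoid the return
  continuation.\<close>

lemma p_oc:
  "pV v v' \<Longrightarrow> (\<forall>n. ocxV n v' \<longrightarrow> ocxV n v) \<and> (\<forall>n. ockV n v' \<longrightarrow> ockV n v)"
  "pQ q q' \<Longrightarrow> (\<forall>n. ocxQ n q' \<longrightarrow> ocxQ n q) \<and> (\<forall>n. ockQ n q' \<longrightarrow> ockQ n q)"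
  "pK k k' \<Longrightarrow> (\<forall>n. ocxK n k' \<longrightarrow> ocxK n k) \<and> (\<forall>n. ockK n k' \<longrightarrow> ockK n k)"
proof (induct rule: pV_pQ_pK.inducts)
  case (pRetb Q Q' W W')
  have "ocxQ n (inst1 W' Q') \<Longrightarrow> ocxQ (Suc n) Q' \<or> ocxV n W'" for n
    by (drule ocx_sb) (simp add: ex_scons; blast)
  moreover have "ockQ n (inst1 W' Q') \<Longrightarrow> ockQ n Q' \<or> ockV n W'" for n
    by (drule ock_sb) (simp add: ex_scons; blast)
  ultimately show ?case using pRetb by (simp, blast)
next
  case (pCalb Q Q' W W' K K')
  have "ocxQ n (inst2 W' K' Q') \<Longrightarrow> ocxQ (Suc n) Q' \<or> ocxV n W' \<or> ocxK n K'" for n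
    by (drule ocx_sb) (simp add: ex_scons; blast)
  moreover have "ockQ n (inst2 W' K' Q') \<Longrightarrow> ockQ (Suc n) Q' \<or> ockV n W' \<or> ockK n K'" for n
    by (drule ock_sb) (simp add: ex_scons; blast)
  ultimately show ?case using pCalb by (simp, blast)
qed (simp_all add: ocx_rn ock_rn)

text \<open>The substitution \<open>?d\<close> is a left inverse of \<open>sh2V\<close> and
  preserves reduction, so \<open>?d X\<close> is the required reduct of \<open>W\<close>. Shifting
  it back gives \<open>X\<close>, because \<open>X\<close> avoids index 0 of both kinds; what
  \<open>?d\<close> puts at index 0 is arbitrary.\<close>

lemma p_sh2V_inv:
  assumes "pV (sh2V W) X" shows "\<exists>W'. X = sh2V W' \<and> pV W W'"
proof -
  let ?d = "sbV (VV 0 \<cdot> VV) (KV 0 \<cdot> KV)"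
  have "\<not> ocxV 0 X" "\<not> ockV 0 X" using p_oc(1)[OF assms] by (auto simp: ocx_rn ock_rn)
  then have "sbV (VV 1 \<cdot> (\<lambda>i. VV (Suc i))) (KV 1 \<cdot> (\<lambda>i. KV (Suc i))) X = sbV VV KV X"
    by (intro sb_cong) (auto simp: scons_def split: nat.split intro!: gr0I)
  then have "sh2V (?d X) = X" by (simp add: rn_sb comp_scons)
  moreover have "pV (?d (sh2V W)) (?d X)" using assms by (intro p_sb) auto
  then have "pV W (?d X)" by (simp add: sb_rn)
  ultimately show ?thesis by metis
qed

lemma p_shK_inv:
  assumes "pK (shK K) X" shows "\<exists>K'. X = shK K' \<and> pK K K'"
proof -
  let ?d = "sbK (VV 0 \<cdot> VV) KV"
  have "\<not> ocxK 0 X" using p_oc(3)[OF assms] by (auto simp: ocx_rn ock_rn)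
  then have "sbK (VV 1 \<cdot> (\<lambda>i. VV (Suc i))) KV X = sbK VV KV X"
    by (intro sb_cong) (auto simp: scons_def split: nat.split intro!: gr0I)
  then have "shK (?d X) = X" by (simp add: rn_sb comp_scons)
  moreover have "pK (?d (shK K)) (?d X)" using assms by (intro p_sb) auto
  then have "pK K (?d X)" by (simp add: sb_rn)
  ultimately show ?thesis by metis
qed

lemma sh_inj: "sh2V v = sh2V w \<Longrightarrow> v = w" "shK k = shK l \<Longrightarrow> k = l"
proof -
  assume "sh2V v = sh2V w"
  then have "sbV (VV 0 \<cdot> VV) (KV 0 \<cdot> KV) (sh2V v) = sbV (VV 0 \<cdot> VV) (KV 0 \<cdot> KV) (sh2V w)" by simp
  then show "v = w" by (simp add: sb_rn)
next
  assume "shK k = shK l"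
  then have "sbK (VV 0 \<cdot> VV) KV (shK k) = sbK (VV 0 \<cdot> VV) KV (shK l)" by simp
  then show "k = l" by (simp add: sb_rn)
qed

inductive_cases pVV_E: "pV (VV i) X"
inductive_cases pVL_E: "pV (VL Q) X"
inductive_cases pRet_E: "pQ (Ret K W) X"
inductive_cases pCal_E: "pQ (Cal V W K) X"
inductive_cases pKV_E: "pK (KV k) X"
inductive_cases pKL_E: "pK (KL Q) X"

text \<open>The rules overlap only where an eta redex contains a beta redex (\<open>W\<close> itself an abstraction), and then
both contractions give \<open>W\<close>.\<close>

lemma pQ_Cal_sh2V:
  assumes "pQ (Cal (sh2V W) (VV 0) (KV 0)) X"
  shows "(\<exists>W'. X = Cal (sh2V W') (VV 0) (KV 0) \<and> pV W W') \<or> (\<exists>Q. W = VL Q \<and> pQ Q X)"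
  using assms
proof (cases rule: pCal_E[consumes 1])
  case (1 V' W' K')
  then show ?thesis by (auto elim!: pVV_E pKV_E dest!: p_sh2V_inv)
next
  case (2 Q Q' W' K')
  from 2(1) obtain Q0 where Q0: "W = VL Q0" "Q = rnQ (up Suc) (up Suc) Q0"
    by (cases W) auto
  have X: "X = inst2 (VV 0) (KV 0) Q'" using 2 by (auto elim!: pVV_E pKV_E)
  \<comment> \<open>\<open>Q\<close> is \<open>Q0\<close> with the two bound indices kept and all
    others raised, so instantiating the bound ones by \<open>VV 0\<close> and \<open>KV 0\<close>
    restores \<open>Q0\<close>.\<close>
  have "(\<lambda>i. (VV 0 \<cdot> VV) (up Suc i)) = VV" "(\<lambda>i. (KV 0 \<cdot> KV) (up Suc i)) = KV"
    by (simp_all add: up_def comp_scons) (rule scons_eqI; simp)+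
  then have "inst2 (VV 0) (KV 0) Q = Q0" by (simp add: Q0 sb_rn)
  moreover have "pQ (inst2 (VV 0) (KV 0) Q) X" unfolding X using 2 by (intro p_inst) auto
  ultimately show ?thesis using Q0 by simp
qed

lemma pQ_Ret_shK:
  assumes "pQ (Ret (shK K) (VV 0)) X"
  shows "(\<exists>K'. X = Ret (shK K') (VV 0) \<and> pK K K') \<or> (\<exists>Q. K = KL Q \<and> pQ Q X)"
  using assms
proof (cases rule: pRet_E[consumes 1])
  case (1 K' W')
  then show ?thesis by (auto elim!: pVV_E dest!: p_shK_inv)
next
  case (2 Q Q' W')
  from 2(1) obtain Q0 where Q0: "K = KL Q0" "Q = rnQ (up Suc) (\<lambda>k. k) Q0"
    by (cases K) auto
  have X: "X = inst1 (VV 0) Q'" using 2 by (auto elim!: pVV_E)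
  have "(\<lambda>i. (VV 0 \<cdot> VV) (up Suc i)) = VV"
    by (simp add: up_def comp_scons) (rule scons_eqI; simp)
  then have "inst1 (VV 0) Q = Q0" by (simp add: Q0 sb_rn)
  moreover have "pQ (inst1 (VV 0) Q) X" unfolding X using 2 by (intro p_inst) auto
  ultimately show ?thesis using Q0 by simp
qed

section \<open>The diamond property, by induction on size\<close>

lemma size_rn [simp]:
  "size (rnV r c v) = size v" "size (rnQ r c q) = size q" "size (rnK r c k) = size k"
  by (induct v and q and k arbitrary: r c and r c and r c) simp_all

definition diaV :: "val \<Rightarrow> bool" where
  "diaV v = (\<forall>a b. pV v a \<longrightarrow> pV v b \<longrightarrow> (\<exists>c. pV a c \<and> pV b c))"
definition diaQ :: "cmd \<Rightarrow> bool" where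
  "diaQ v = (\<forall>a b. pQ v a \<longrightarrow> pQ v b \<longrightarrow> (\<exists>c. pQ a c \<and> pQ b c))"
definition diaK :: "kon \<Rightarrow> bool" where
  "diaK v = (\<forall>a b. pK v a \<longrightarrow> pK v b \<longrightarrow> (\<exists>c. pK a c \<and> pK b c))"

text \<open>Here \<open>a\<close> arises by contracting the outer eta redex. If the competing step
  only reduces inside \<open>W\<close>, the eta redex survives and is contracted afterwards;
  otherwise \<open>b\<close> is itself a reduct of \<open>W\<close>, and the diamond property of the
  smaller value \<open>W\<close> closes the diagram.\<close>

lemma dia_VL_aux:
  assumes W: "diaV W" and a: "pV W a" and b: "pV (VL (Cal (sh2V W) (VV 0) (KV 0))) b"
  shows "\<exists>c. pV a c \<and> pV b c"
  using b
proof (cases rule: pVL_E[consumes 1])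
  case (1 Q')
  from pQ_Cal_sh2V[OF 1(2)] show ?thesis
  proof (elim disjE exE conjE)
    fix W' assume Q': "Q' = Cal (sh2V W') (VV 0) (KV 0)" "pV W W'"
    with W a obtain c where "pV a c" "pV W' c" unfolding diaV_def by blast
    then show ?thesis using 1 Q' by (auto intro: pVeta)
  next
    fix Q0 assume "W = VL Q0" "pQ Q0 Q'"
    then have "pV W b" using 1 by (auto intro: pVL)
    then show ?thesis using W a unfolding diaV_def by blast
  qed
next
  case (2 W')
  then have "pV W b" by (auto dest: sh_inj)
  then show ?thesis using W a unfolding diaV_def by blast
qed

lemma dia_KL_aux:
  assumes K: "diaK K" and a: "pK K a" and b: "pK (KL (Ret (shK K) (VV 0))) b"
  shows "\<exists>c. pK a c \<and> pK b c"
  using b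
proof (cases rule: pKL_E[consumes 1])
  case (1 Q')
  from pQ_Ret_shK[OF 1(2)] show ?thesis
  proof (elim disjE exE conjE)
    fix K' assume Q': "Q' = Ret (shK K') (VV 0)" "pK K K'"
    with K a obtain c where "pK a c" "pK K' c" unfolding diaK_def by blast
    then show ?thesis using 1 Q' by (auto intro: pKeta)
  next
    fix Q0 assume "K = KL Q0" "pQ Q0 Q'"
    then have "pK K b" using 1 by (auto intro: pKL)
    then show ?thesis using K a unfolding diaK_def by blast
  qed
next
  case (2 K')
  then have "pK K b" by (auto dest: sh_inj)
  then show ?thesis using K a unfolding diaK_def by blast
qed

lemma dia_VL:
  assumes Q: "diaQ Q" and sub: "\<And>W. size W < size Q \<Longrightarrow> diaV W"
  shows "diaV (VL Q)"
  unfolding diaV_def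
proof (intro allI impI)
  fix a b assume a: "pV (VL Q) a" and b: "pV (VL Q) b"
  have eta: "\<exists>c. pV x c \<and> pV y c"
    if "Q = Cal (sh2V W) (VV 0) (KV 0)" "pV W x" "pV (VL Q) y" for W x y
    using that by (intro dia_VL_aux[of W]) (auto intro: sub)
  from a show "\<exists>c. pV a c \<and> pV b c"
  proof (cases rule: pVL_E[consumes 1])
    case (1 Qa)
    note A = this
    from b show ?thesis
    proof (cases rule: pVL_E[consumes 1])
      case (1 Qb)
      with A Q show ?thesis unfolding diaQ_def by (meson pVL)
    next
      case (2 W)
      then show ?thesis using eta a by blast
    qed
  next
    case (2 W)
    then show ?thesis using eta b by blast
  qed
qed

lemma dia_KL:
  assumes Q: "diaQ Q" and sub: "\<And>K. size K < size Q \<Longrightarrow> diaK K"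
  shows "diaK (KL Q)"
  unfolding diaK_def
proof (intro allI impI)
  fix a b assume a: "pK (KL Q) a" and b: "pK (KL Q) b"
  have eta: "\<exists>c. pK x c \<and> pK y c"
    if "Q = Ret (shK K) (VV 0)" "pK K x" "pK (KL Q) y" for K x y
    using that by (intro dia_KL_aux[of K]) (auto intro: sub)
  from a show "\<exists>c. pK a c \<and> pK b c"
  proof (cases rule: pKL_E[consumes 1])
    case (1 Qa)
    note A = this
    from b show ?thesis
    proof (cases rule: pKL_E[consumes 1])
      case (1 Qb)
      with A Q show ?thesis unfolding diaQ_def by (meson pKL)
    next
      case (2 W)
      then show ?thesis using eta a by blast
    qed
  next
    case (2 W)
    then show ?thesis using eta b by blast
  qed
qed

text \<open>When the outer abstraction is an eta redex whose body was beta reduced, the claim is that of the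
command without the eta expansion; hence the induction on size rather than on derivations.\<close>

lemma dia_Ret:
  assumes K: "diaK K" and W: "diaV W" and sub: "\<And>Q. size Q < size (Ret K W) \<Longrightarrow> diaQ Q"
  shows "diaQ (Ret K W)"
proof -
  have mixed: "\<exists>c. pQ (Ret K1 W1) c \<and> pQ (inst1 W2 Q2) c"
    if KQ: "K = KL Q" and p: "pK K K1" "pV W W1" "pQ Q Q2" "pV W W2" for Q K1 W1 Q2 W2
  proof -
    obtain W3 where W3: "pV W1 W3" "pV W2 W3" using W p unfolding diaV_def by blast
    from p(1)[unfolded KQ] show ?thesis
    proof (cases rule: pKL_E[consumes 1])
      case (1 Q1)
      have "diaQ Q" using sub KQ by simp
      with 1 p obtain Q3 where "pQ Q1 Q3" "pQ Q2 Q3" unfolding diaQ_def by blast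
      with 1 W3 show ?thesis by (auto intro: pRetb p_inst)
    next
      case (2 K0)
      from pQ_Ret_shK[OF p(3)[unfolded 2(1)]] show ?thesis
      proof (elim disjE exE conjE)
        fix K' assume K': "Q2 = Ret (shK K') (VV 0)" "pK K0 K'"
        have "\<exists>c. pQ (Ret K1 W1) c \<and> pQ (Ret K' W2) c"
          using sub[of "Ret K0 W"] KQ 2 K' p unfolding diaQ_def by (auto intro: pRet)
        then show ?thesis using K' by (simp add: sb_rn)
      next
        fix Q0 assume "K0 = KL Q0" "pQ Q0 Q2"
        then show ?thesis using sub[of "Ret K0 W"] KQ 2 p unfolding diaQ_def
          by (simp, meson pRet pRetb)
      qed
    qed
  qed
  show ?thesis
    unfolding diaQ_def
  proof (intro allI impI)
    fix a b assume a: "pQ (Ret K W) a" and b: "pQ (Ret K W) b"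
    from a show "\<exists>c. pQ a c \<and> pQ b c"
    proof (cases rule: pRet_E[consumes 1])
      case (1 K1 W1)
      note A = this
      from b show ?thesis
      proof (cases rule: pRet_E[consumes 1])
        case (1 K2 W2)
        with A K W show ?thesis unfolding diaK_def diaV_def by (meson pRet)
      next
        case (2 Q Q2 W2)
        then show ?thesis using mixed A by blast
      qed
    next
      case (2 Q Q1 W1)
      note A = this
      from b show ?thesis
      proof (cases rule: pRet_E[consumes 1])
        case (1 K2 W2)
        then show ?thesis using mixed A by blast
      next
        case (2 Q' Q2 W2)
        have "diaQ Q" using sub A by simp
        moreover have "pQ Q Q2" using A 2 by simp
        ultimately obtain Q3 where "pQ Q1 Q3" "pQ Q2 Q3" using A unfolding diaQ_def by blast
        moreover obtain W3 where "pV W1 W3" "pV W2 W3" using A 2 W unfolding diaV_def by blast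
        ultimately show ?thesis using A 2 by (blast intro: p_inst)
      qed
    qed
  qed
qed

lemma dia_Cal:
  assumes V: "diaV V" and W: "diaV W" and K: "diaK K"
    and sub: "\<And>Q. size Q < size (Cal V W K) \<Longrightarrow> diaQ Q"
  shows "diaQ (Cal V W K)"
proof -
  have mixed: "\<exists>c. pQ (Cal V1 W1 K1) c \<and> pQ (inst2 W2 K2 Q2) c"
    if VQ: "V = VL Q" and p: "pV V V1" "pV W W1" "pK K K1" "pQ Q Q2" "pV W W2" "pK K K2"
    for Q V1 K1 W1 Q2 W2 K2
  proof -
    obtain W3 where W3: "pV W1 W3" "pV W2 W3" using W p unfolding diaV_def by blast
    obtain K3 where K3: "pK K1 K3" "pK K2 K3" using K p unfolding diaK_def by blast
    from p(1)[unfolded VQ] show ?thesis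
    proof (cases rule: pVL_E[consumes 1])
      case (1 Q1)
      have "diaQ Q" using sub VQ by simp
      with 1 p obtain Q3 where "pQ Q1 Q3" "pQ Q2 Q3" unfolding diaQ_def by blast
      with 1 W3 K3 show ?thesis by (auto intro: pCalb p_inst)
    next
      case (2 V0)
      from pQ_Cal_sh2V[OF p(4)[unfolded 2(1)]] show ?thesis
      proof (elim disjE exE conjE)
        fix V' assume V': "Q2 = Cal (sh2V V') (VV 0) (KV 0)" "pV V0 V'"
        have "\<exists>c. pQ (Cal V1 W1 K1) c \<and> pQ (Cal V' W2 K2) c"
          using sub[of "Cal V0 W K"] VQ 2 V' p unfolding diaQ_def by (auto intro: pCal)
        then show ?thesis using V' by (simp add: sb_rn)
      next
        fix Q0 assume "V0 = VL Q0" "pQ Q0 Q2"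
        then show ?thesis using sub[of "Cal V0 W K"] VQ 2 p unfolding diaQ_def
          by (simp, meson pCal pCalb)
      qed
    qed
  qed
  show ?thesis
    unfolding diaQ_def
  proof (intro allI impI)
    fix a b assume a: "pQ (Cal V W K) a" and b: "pQ (Cal V W K) b"
    from a show "\<exists>c. pQ a c \<and> pQ b c"
    proof (cases rule: pCal_E[consumes 1])
      case (1 V1 W1 K1)
      note A = this
      from b show ?thesis
      proof (cases rule: pCal_E[consumes 1])
        case (1 V2 W2 K2)
        with A K V W show ?thesis unfolding diaK_def diaV_def by (meson pCal)
      next
        case (2 Q Q2 W2 K2)
        then show ?thesis using mixed A by blast
      qed
    next
      case (2 Q Q1 W1 K1)
      note A = this
      from b show ?thesis
      proof (cases rule: pCal_E[consumes 1])
        case (1 V2 W2 K2)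
        then show ?thesis using mixed A by blast
      next
        case (2 Q' Q2 W2 K2)
        have "diaQ Q" using sub A by simp
        moreover have "pQ Q Q2" using A 2 by simp
        ultimately obtain Q3 where "pQ Q1 Q3" "pQ Q2 Q3" using A unfolding diaQ_def by blast
        moreover obtain W3 where "pV W1 W3" "pV W2 W3" using A 2 W unfolding diaV_def by blast
        moreover obtain K3 where "pK K1 K3" "pK K2 K3" using A 2 K unfolding diaK_def by blast
        ultimately show ?thesis using A 2 by (blast intro: p_inst)
      qed
    qed
  qed
qed

lemma dia_all:
  "(\<forall>v. size v < n \<longrightarrow> diaV v) \<and> (\<forall>q. size q < n \<longrightarrow> diaQ q) \<and> (\<forall>k. size k < n \<longrightarrow> diaK k)"
proof (induct n)
  case (Suc n)
  then have IH: "\<And>v. size v < n \<Longrightarrow> diaV v" "\<And>q. size q < n \<Longrightarrow> diaQ q" "\<And>k. size k < n \<Longrightarrow> diaK k"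
    by auto
  have "diaV v" if "size v < Suc n" for v
  proof (cases v)
    case (VV i)
    then show ?thesis unfolding diaV_def by (blast elim: pVV_E)
  next
    case (VL q)
    then show ?thesis using that by (simp, intro dia_VL) (auto intro: IH)
  qed
  moreover have "diaQ q" if "size q < Suc n" for q
    using that by (cases q; simp, intro dia_Ret dia_Cal) (auto intro: IH)
  moreover have "diaK k" if "size k < Suc n" for k
  proof (cases k)
    case (KV i)
    then show ?thesis unfolding diaK_def by (blast elim: pKV_E)
  next
    case (KL q)
    then show ?thesis using that by (simp, intro dia_KL) (auto intro: IH)
  qed
  ultimately show ?case by blast
qed simp

lemma pQ_diamond: "pQ q a \<Longrightarrow> pQ q b \<Longrightarrow> \<exists>c. pQ a c \<and> pQ b c"
  using dia_all[of "Suc (size q)"] unfolding diaQ_def by blast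

lemma pQ_strip: "pQ\<^sup>*\<^sup>* q a \<Longrightarrow> pQ q b \<Longrightarrow> \<exists>c. pQ a c \<and> pQ\<^sup>*\<^sup>* b c"
proof (induct rule: rtranclp_induct)
  case (step y z)
  then show ?case by (meson pQ_diamond rtranclp.rtrancl_into_rtrancl)
qed blast

lemma pQ_join:
  assumes "(\<lambda>a b. pQ a b \<or> pQ b a)\<^sup>*\<^sup>* a b"
  shows "\<exists>c. pQ\<^sup>*\<^sup>* a c \<and> pQ\<^sup>*\<^sup>* b c"
  using assms
proof (induct rule: rtranclp_induct)
  case (step y z)
  then obtain c where c: "pQ\<^sup>*\<^sup>* a c" "pQ\<^sup>*\<^sup>* y c" by blast
  from step(2) show ?case
  proof
    assume "pQ y z"
    then obtain d where "pQ c d" "pQ\<^sup>*\<^sup>* z d" using pQ_strip c by blast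
    then show ?thesis using c by (meson rtranclp.rtrancl_into_rtrancl)
  next
    assume "pQ z y"
    then show ?thesis using c by (meson converse_rtranclp_into_rtranclp)
  qed
qed blast

section \<open>Translation into the target calculus\<close>

primrec the_val :: "cmd \<Rightarrow> val" where
  "the_val (Ret K W) = W"
| "the_val (Cal V W K) = V"

text \<open>\<open>tr s t M K\<close> is the command \<open>M : K\<close> of the colon translation, where \<open>s\<close> and \<open>t\<close> interpret the
free variables of \<open>M\<close>. Since \<open>\<mu>k.J\<close> merely binds \<open>k\<close> to \<open>K\<close> in the environment, (E1)-(E3) and the
rules for \<open>\<mu>\<close> become equalities. \<open>the_val\<close> is only applied to translations of values, which are
of the form \<open>Ret\<close>.\<close>

primrec tr :: "(nat \<Rightarrow> val) \<Rightarrow> (nat \<Rightarrow> kon) \<Rightarrow> trm \<Rightarrow> kon \<Rightarrow> cmd"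
    and trj :: "(nat \<Rightarrow> val) \<Rightarrow> (nat \<Rightarrow> kon) \<Rightarrow> jmp \<Rightarrow> cmd" where
  "tr s t (Var i) K = Ret K (s i)"
| "tr s t (Lam m) K = Ret K (VL (tr (lV s) (\<lambda>k. sh2K (t k)) m (KV 0)))"
| "tr s t (App m n) K =
    (if is_val m then
       if is_val n then Cal (the_val (tr s t m (KV 0))) (the_val (tr s t n (KV 0))) K
       else tr s t n (KL (Cal (shV (the_val (tr s t m (KV 0)))) (VV 0) (shK K)))
     else
       if is_val n then tr s t m (KL (Cal (VV 0) (shV (the_val (tr s t n (KV 0)))) (shK K)))
       else tr s t m (KL (tr (\<lambda>i. shV (s i)) (\<lambda>k. shK (t k)) n (KL (Cal (VV 1) (VV 0) (shK (shK K)))))))"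
| "tr s t (Wh l m) K = tr s t m (KL (tr (xV s) (\<lambda>k. shK (t k)) l (shK K)))"
| "tr s t (Mu j) K = trj s (K \<cdot> t) j"
| "trj s t (Jmp k m) = tr s t m (t k)"
| "trj s t (JWh j m) = tr s t m (KL (trj (xV s) (\<lambda>k. shK (t k)) j))"

definition trv :: "(nat \<Rightarrow> val) \<Rightarrow> (nat \<Rightarrow> kon) \<Rightarrow> trm \<Rightarrow> val" where
  "trv s t m = the_val (tr s t m (KV 0))"

lemma tr_val: "is_val m \<Longrightarrow> tr s t m K = Ret K (trv s t m)"
  by (cases m) (simp_all add: trv_def)

lemma sb_shift2: "sbK (lV s) (lK t) (sh2K k) = sh2K (sbK s t k)"
  by (simp add: rn_sb sb_rn lV_def lK_def)

lemma trv_from_tr: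
  assumes "\<And>K. sbQ s' t' (tr s t m K) = tr s1 t1 m (sbK s' t' K)" "is_val m"
  shows "sbV s' t' (trv s t m) = trv s1 t1 m"
  using assms(1)[of "KV 0"] by (simp add: tr_val assms(2))

lemma sb_tr:
  "sbQ s' t' (tr s t m K) = tr (\<lambda>i. sbV s' t' (s i)) (\<lambda>k. sbK s' t' (t k)) m (sbK s' t' K)"
  "sbQ s' t' (trj s t j) = trj (\<lambda>i. sbV s' t' (s i)) (\<lambda>k. sbK s' t' (t k)) j"
proof (induct m and j arbitrary: s t s' t' K and s t s' t')
  case (App m n)
  have m: "is_val m \<Longrightarrow> sbV s' t' (trv s t m) = trv (\<lambda>i. sbV s' t' (s i)) (\<lambda>k. sbK s' t' (t k)) m" for s t s' t'
    by (rule trv_from_tr[OF App(1)])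
  have n: "is_val n \<Longrightarrow> sbV s' t' (trv s t n) = trv (\<lambda>i. sbV s' t' (s i)) (\<lambda>k. sbK s' t' (t k)) n" for s t s' t'
    by (rule trv_from_tr[OF App(2)])
  have [simp]: "xV s 0 = VV 0" "xV s (Suc i) = shV (s i)" for s i by (simp_all add: xV_def)
  show ?case
    by (simp add: App trv_def[symmetric] m n sb_shift)
qed (simp_all add: sb_env sb_shift sb_shift2 comp_scons, simp_all add: lK_def)

lemma rn_as_sb:
  "rnV r c v = sbV (\<lambda>i. VV (r i)) (\<lambda>k. KV (c k)) v"
  "rnQ r c q = sbQ (\<lambda>i. VV (r i)) (\<lambda>k. KV (c k)) q"
  "rnK r c k = sbK (\<lambda>i. VV (r i)) (\<lambda>k. KV (c k)) k"
  using rn_sb[of r c VV KV] by simp_all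

lemma rn_tr:
  "rnQ r c (tr s t m K) = tr (\<lambda>i. rnV r c (s i)) (\<lambda>k. rnK r c (t k)) m (rnK r c K)"
  "rnQ r c (trj s t j) = trj (\<lambda>i. rnV r c (s i)) (\<lambda>k. rnK r c (t k)) j"
  by (simp_all only: rn_as_sb sb_tr)

lemma rn_trv: "is_val m \<Longrightarrow> rnV r c (trv s t m) = trv (\<lambda>i. rnV r c (s i)) (\<lambda>k. rnK r c (t k)) m"
  using rn_tr(1)[of r c s t m "KV 0"] by (simp add: tr_val)

lemma tr_App:
  "tr s t (App m n) K =
    (if is_val m then
       if is_val n then Cal (trv s t m) (trv s t n) K
       else tr s t n (KL (Cal (shV (trv s t m)) (VV 0) (shK K)))
     else
       if is_val n then tr s t m (KL (Cal (VV 0) (shV (trv s t n)) (shK K)))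
       else tr s t m (KL (tr (\<lambda>i. shV (s i)) (\<lambda>k. shK (t k)) n (KL (Cal (VV 1) (VV 0) (shK (shK K)))))))"
  by (simp add: trv_def)

declare tr.simps(3) [simp del]
declare tr_App [simp]

lemma trv_simps [simp]:
  "trv s t (Var i) = s i"
  "trv s t (Lam m) = VL (tr (lV s) (\<lambda>k. sh2K (t k)) m (KV 0))"
  by (simp_all add: trv_def)

lemma is_val_ops [simp]:
  "is_val (liftT c m) = is_val m" "is_val (liftK c m) = is_val m" "is_val (renK c l m) = is_val m"
  "is_val (sst c L m) = is_val m"
  by (cases m; simp)+

lemma is_val_substT [simp]: "is_val V \<Longrightarrow> is_val (substT n V m) = is_val m"
  by (cases m) simp_all

section \<open>Source operations as changes of the environment of the translation\<close>

definition shift :: "nat \<Rightarrow> nat \<Rightarrow> nat" where "shift c i = (if c \<le> i then Suc i else i)"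

lemma shift_simps [simp]: "shift 0 i = Suc i" "shift (Suc c) 0 = 0" "shift (Suc c) (Suc i) = Suc (shift c i)"
  by (simp_all add: shift_def)

lemma env_shift:
  "(\<lambda>i. xV s (shift (Suc c) i)) = xV (\<lambda>i. s (shift c i))"
  "(\<lambda>i. lV s (shift (Suc c) i)) = lV (\<lambda>i. s (shift c i))"
  by (rule ext, case_tac i; simp add: xV_def lV_def)+

lemma scons_shift: "(\<lambda>i. (K \<cdot> t) (shift (Suc c) i)) = K \<cdot> (\<lambda>i. t (shift c i))"
  by (rule ext, case_tac i; simp)

lemma tr_liftT_aux:
  "tr s t (liftT c m) K = tr (\<lambda>i. s (shift c i)) t m K"
  "trj s t (liftTj c j) = trj (\<lambda>i. s (shift c i)) t j"
proof (induct m and j arbitrary: s t c K and s t c)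
  case (App m n)
  then show ?case by (simp add: trv_def)
qed (simp_all add: env_shift, simp add: shift_def)

lemma tr_liftK_aux:
  "tr s t (liftK c m) K = tr s (\<lambda>i. t (shift c i)) m K"
  "trj s t (liftKj c j) = trj s (\<lambda>i. t (shift c i)) j"
proof (induct m and j arbitrary: s t c K and s t c)
  case (App m n)
  then show ?case by (simp add: trv_def)
qed (simp_all add: scons_shift, simp add: shift_def)

lemma trv_lift:
  "trv s t (liftT c m) = trv (\<lambda>i. s (shift c i)) t m"
  "trv s t (liftK c m) = trv s (\<lambda>i. t (shift c i)) m"
  by (simp_all add: trv_def tr_liftT_aux tr_liftK_aux)

lemmas tr_lift = tr_liftT_aux tr_liftK_aux trv_lift

definition rnm :: "nat \<Rightarrow> nat \<Rightarrow> nat \<Rightarrow> nat" where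
  "rnm c l k = (if k = c then l else if c < k then k - 1 else k)"

lemma scons_rnm: "(\<lambda>i. (K \<cdot> t) (rnm (Suc c) (Suc l) i)) = K \<cdot> (\<lambda>i. t (rnm c l i))"
proof
  fix i show "(K \<cdot> t) (rnm (Suc c) (Suc l) i) = (K \<cdot> (\<lambda>i. t (rnm c l i))) i"
  proof (cases i)
    case (Suc j) then show ?thesis by (cases j) (auto simp: rnm_def)
  qed (simp add: rnm_def)
qed

lemma tr_renK:
  "tr s t (renK c l m) K = tr s (\<lambda>i. t (rnm c l i)) m K"
  "trj s t (renKj c l j) = trj s (\<lambda>i. t (rnm c l i)) j"
proof (induct m and j arbitrary: s t c l K and s t c l)
  case (App m n)
  then show ?case by (simp add: trv_def)
qed (simp_all add: scons_rnm, simp add: rnm_def)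

definition insV :: "nat \<Rightarrow> val \<Rightarrow> (nat \<Rightarrow> val) \<Rightarrow> nat \<Rightarrow> val" where
  "insV n V s i = (if i = n then V else if n < i then s (i - 1) else s i)"

lemma insV_env:
  "xV (insV n V s) = insV (Suc n) (shV V) (xV s)"
  "lV (insV n V s) = insV (Suc n) (sh2V V) (lV s)"
  "(\<lambda>i. rnV r c (insV n V s i)) = insV n (rnV r c V) (\<lambda>i. rnV r c (s i))"
proof -
  show "xV (insV n V s) = insV (Suc n) (shV V) (xV s)"
  proof
    fix i show "xV (insV n V s) i = insV (Suc n) (shV V) (xV s) i"
    proof (cases i)
      case (Suc j) then show ?thesis by (cases j) (auto simp: insV_def xV_def)
    qed (simp add: insV_def xV_def)
  qed
  show "lV (insV n V s) = insV (Suc n) (sh2V V) (lV s)"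
  proof
    fix i show "lV (insV n V s) i = insV (Suc n) (sh2V V) (lV s) i"
    proof (cases i)
      case (Suc j) then show ?thesis by (cases j) (auto simp: insV_def lV_def)
    qed (simp add: insV_def lV_def)
  qed
qed (auto simp: insV_def)

lemma trv_liftT0:
  assumes "is_val V"
  shows "trv (xV s) (\<lambda>k. shK (t k)) (liftT 0 V) = shV (trv s t V)"
    "trv (lV s) (\<lambda>k. sh2K (t k)) (liftT 0 V) = sh2V (trv s t V)"
    "trv s (K \<cdot> t) (liftK 0 V) = trv s t V"
  using assms by (simp_all add: tr_lift rn_trv xV_def lV_def)

lemma tr_substT:
  "is_val V \<Longrightarrow> tr s t (substT n V m) K = tr (insV n (trv s t V) s) t m K"
  "is_val V \<Longrightarrow> trj s t (substTj n V j) = trj (insV n (trv s t V) s) t j"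
proof (induct m and j arbitrary: s t n V K and s t n V)
  case (Var i)
  then show ?case by (simp add: insV_def tr_val)
next
  case (App m n)
  then show ?case by (simp add: trv_def[symmetric] insV_env(3) rn_trv) (simp add: trv_def App)
qed (simp_all add: trv_liftT0 insV_env)

text \<open>Structural substitution does not consume index \<open>c\<close>. It rebinds
  \<open>c\<close> to the continuation that runs \<open>L\<close> on its argument and hands the
  result to the old continuation.\<close>

definition setK :: "nat \<Rightarrow> (nat \<Rightarrow> val) \<Rightarrow> trm \<Rightarrow> (nat \<Rightarrow> kon) \<Rightarrow> nat \<Rightarrow> kon" where
  "setK c s L t = t(c := KL (tr (xV s) (\<lambda>k. shK (t k)) L (shK (t c))))"

lemma setK_env:
  "setK c (xV s) (liftT 1 L) (\<lambda>k. shK (t k)) = (\<lambda>k. shK (setK c s L t k))"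
  "setK c (\<lambda>i. shV (s i)) L (\<lambda>k. shK (t k)) = (\<lambda>k. shK (setK c s L t k))"
  "setK c (lV s) (liftT 1 L) (\<lambda>k. sh2K (t k)) = (\<lambda>k. sh2K (setK c s L t k))"
  by (rule ext; simp add: setK_def tr_lift rn_tr rn_rn scons_shift xV_def lV_def comp_scons)+

lemma setK_scons: "setK (Suc c) s (liftK 0 L) (K \<cdot> t) = K \<cdot> setK c s L t"
  by (rule ext, case_tac x; simp add: setK_def tr_lift rn_tr rn_rn)

lemma tr_sst:
  "tr s t (sst c L m) K = tr s (setK c s L t) m K"
  "trj s t (sstj c L j) = trj s (setK c s L t) j"
proof (induct m and j arbitrary: s t c L K and s t c L)
  case (App m n)
  from App show ?case by (simp add: trv_def setK_env(2))
next
  case (Jmp k m)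
  then show ?case by (simp add: setK_def)
qed (simp_all add: setK_env[simplified] setK_scons)


text \<open>In \<open>Wh l m\<close> the translation of \<open>l\<close> sits in the continuation
  passed to \<open>m\<close>. A step in \<open>l\<close> is therefore a step of a continuation, and
  this lemma carries it through the translation of \<open>m\<close>.\<close>

lemma p_tr:
  "(\<And>k. pK (t k) (t' k)) \<Longrightarrow> pK K K' \<Longrightarrow> pQ (tr s t m K) (tr s t' m K')"
  "(\<And>k. pK (t k) (t' k)) \<Longrightarrow> pQ (trj s t j) (trj s t' j)"
proof (induct m and j arbitrary: s t t' K K' and s t t')
  case (App m n)
  have v: "is_val m \<Longrightarrow> pV (trv s t m) (trv s t' m)" "is_val n \<Longrightarrow> pV (trv s t n) (trv s t' n)"
    using App(1)[of t t' "KV 0" "KV 0" s] App(2)[of t t' "KV 0" "KV 0" s] App(3)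
    by (auto simp: tr_val elim: pRet_E)
  show ?case
    using App.prems v by (auto intro!: App.hyps pCal p_rn pKL)
next
  case (Mu j)
  then show ?case by (auto intro!: Mu(1) simp: scons_def split: nat.split)
next
  case (Lam m)
  then show ?case by (simp, intro pRet pVL Lam.hyps p_rn p_refl)
next
  case (Wh l m)
  then show ?case by (simp, intro Wh.hyps pKL p_rn)
next
  case (JWh j m)
  then show ?case by (simp, intro JWh.hyps pKL p_rn)
qed (auto intro!: pRet)

section \<open>Soundness: source equality becomes target conversion\<close>

abbreviation conv :: "cmd \<Rightarrow> cmd \<Rightarrow> bool" where
  "conv \<equiv> (\<lambda>a b. pQ a b \<or> pQ b a)\<^sup>*\<^sup>*"

lemma conv_sym: "conv a b \<Longrightarrow> conv b a"
  by (induct rule: rtranclp_induct) (auto intro: converse_rtranclp_into_rtranclp)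

lemma conv_map:
  assumes "conv a b" "\<And>a b. pQ a b \<Longrightarrow> pQ (f a) (f b)"
  shows "conv (f a) (f b)"
  using assms(1)
proof (induct rule: rtranclp_induct)
  case (step y z)
  then have "pQ (f y) (f z) \<or> pQ (f z) (f y)" using assms(2) by blast
  with step(3) show ?case by (rule rtranclp.rtrancl_into_rtrancl)
qed simp

text \<open>The clause on \<open>is_val\<close> is carried along for the congruence rule of
  applications, where \<open>tr\<close> branches on it.\<close>

lemma eqT_sound:
  "eqT a b \<Longrightarrow> is_val a = is_val b \<and> (\<forall>s t K. tr s t a K = tr s t b K)"
  "eqJ i j \<Longrightarrow> (\<forall>s t. trj s t i = trj s t j)"
proof (induct rule: eqT_eqJ.inducts)
  case (cApp s s' t t')
  then show ?case by (simp add: trv_def)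
qed (simp_all add: tr_lift env_shift scons_shift rn_tr xV_def comp_scons rn_rn)

text \<open>The continuation of the operator in a translation that treats all applications alike. A
  step may turn a non-value into a value and so change the branch taken by \<open>tr\<close>;
  comparing both sides with this uniform translation avoids following such changes.\<close>

definition appK :: "(nat \<Rightarrow> val) \<Rightarrow> (nat \<Rightarrow> kon) \<Rightarrow> trm \<Rightarrow> kon \<Rightarrow> kon" where
  "appK s t n K = KL (tr (\<lambda>i. shV (s i)) (\<lambda>k. shK (t k)) n (KL (Cal (VV 1) (VV 0) (shK (shK K)))))"

lemma conv_pQ: "pQ a b \<Longrightarrow> conv a b" by blast

lemma tr_App_conv: "conv (tr s t (App m n) K) (tr s t m (appK s t n K))"
proof (cases "is_val m")
  case True
  have "pQ (Ret (appK s t n K) (trv s t m)) (inst1 (trv s t m) (tr (\<lambda>i. shV (s i)) (\<lambda>k. shK (t k)) n (KL (Cal (VV 1) (VV 0) (shK (shK K))))))"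
    unfolding appK_def by (intro pRetb) auto
  also have "inst1 (trv s t m) (tr (\<lambda>i. shV (s i)) (\<lambda>k. shK (t k)) n (KL (Cal (VV 1) (VV 0) (shK (shK K)))))
    = tr s t n (KL (Cal (shV (trv s t m)) (VV 0) (shK K)))"
    by (simp add: sb_tr sb_rn xV_def) (simp add: rn_as_sb)
  finally have 1: "conv (tr s t m (appK s t n K)) (tr s t n (KL (Cal (shV (trv s t m)) (VV 0) (shK K))))"
    using True by (simp add: tr_val conv_pQ)
  show ?thesis
  proof (cases "is_val n")
    case n: True
    have "pQ (Ret (KL (Cal (shV (trv s t m)) (VV 0) (shK K))) (trv s t n)) (inst1 (trv s t n) (Cal (shV (trv s t m)) (VV 0) (shK K)))"
      by (intro pRetb) auto
    then have "conv (tr s t n (KL (Cal (shV (trv s t m)) (VV 0) (shK K)))) (tr s t (App m n) K)"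
      using True n by (simp add: tr_val conv_pQ sb_rn)
    with 1 show ?thesis using conv_sym by (meson rtranclp_trans)
  next
    case False
    then show ?thesis using True 1 conv_sym by simp
  qed
next
  case False
  show ?thesis
  proof (cases "is_val n")
    case n: True
    let ?q = "Cal (VV 1) (VV 0) (shK (shK K))"
    let ?V = "shV (trv s t n)"
    have "pQ (Ret (KL ?q) ?V) (inst1 ?V ?q)" by (intro pRetb) auto
    also have "inst1 ?V ?q = Cal (VV 0) ?V (shK K)" by (simp add: sb_rn) (simp add: rn_as_sb)
    finally have "pK (appK s t n K) (KL (Cal (VV 0) ?V (shK K)))"
      unfolding appK_def using n by (intro pKL) (simp add: tr_val rn_trv)
    then have "pQ (tr s t m (appK s t n K)) (tr s t m (KL (Cal (VV 0) ?V (shK K))))"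
      by (intro p_tr) auto
    then show ?thesis using False n by (simp add: r_into_rtranclp)
  qed (simp add: False appK_def)
qed

lemma tr_App_congr:
  assumes "\<And>s t K. conv (tr s t m K) (tr s t m' K)" "\<And>s t K. conv (tr s t n K) (tr s t n' K)"
  shows "conv (tr s t (App m n) K) (tr s t (App m' n') K)"
proof -
  have "conv (tr s t (App m n) K) (tr s t m (appK s t n K))" by (rule tr_App_conv)
  also have "conv (tr s t m (appK s t n K)) (tr s t m (appK s t n' K))"
    unfolding appK_def by (rule conv_map[OF assms(2)]) (auto intro!: p_tr pKL)
  also have "conv (tr s t m (appK s t n' K)) (tr s t m' (appK s t n' K))" by (rule assms)
  also have "conv (tr s t m' (appK s t n' K)) (tr s t (App m' n') K)"
    by (rule conv_sym[OF tr_App_conv])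
  finally show ?thesis .
qed

lemma insV_0: "insV 0 V s = V \<cdot> s"
  by (rule ext, case_tac x; simp add: insV_def)

lemma inst1_tr: "inst1 V (tr (xV s) (\<lambda>k. shK (t k)) m (shK K)) = tr (V \<cdot> s) t m K"
  by (simp add: sb_tr sb_rn xV_def comp_scons)

text \<open>This equality and \<open>tr_nv2\<close> are the gain from the case split on values in
  \<open>tr\<close>: naming a non-value leaves no administrative redex.
  \<open>adequate_expand\<close> relies on exact equality here.\<close>

lemma tr_nv1: "\<not> is_val n \<Longrightarrow> tr s t (App n m) K = tr s t (Wh (App (Var 0) (liftT 0 m)) n) K"
  by (simp add: tr_lift rn_trv xV_def)

lemma tr_nv2:
  "is_val m \<Longrightarrow> \<not> is_val n \<Longrightarrow> tr s t (App m n) K = tr s t (Wh (App (liftT 0 m) (Var 0)) n) K"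
  by (simp add: tr_lift rn_trv xV_def)

lemma redT_sound:
  "redT a b \<Longrightarrow> conv (tr s t a K) (tr s t b K)"
  "redJ i j \<Longrightarrow> conv (trj s t i) (trj s t j)"
proof (induct arbitrary: s t K and s t rule: redT_redJ.inducts)
  case (r_nv1 N M)
  show ?case unfolding tr_nv1[OF r_nv1] by (rule rtranclp.rtrancl_refl)
next
  case (r_nv2 V N)
  show ?case unfolding tr_nv2[OF r_nv2] by (rule rtranclp.rtrancl_refl)
next
  case (r_beta V M)
  have "pQ (Cal (trv s t (Lam M)) (trv s t V) K) (inst2 (trv s t V) K (tr (lV s) (\<lambda>k. sh2K (t k)) M (KV 0)))"
    by (simp, intro pCalb) auto
  also have "inst2 (trv s t V) K (tr (lV s) (\<lambda>k. sh2K (t k)) M (KV 0)) = tr (trv s t V \<cdot> s) t M K"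
    by (simp add: sb_tr sb_rn lV_def comp_scons)
  finally have 1: "conv (tr s t (App (Lam M) V) K) (tr (trv s t V \<cdot> s) t M K)"
    using r_beta by (simp add: conv_pQ)
  have "pQ (tr s t (Wh M V) K) (inst1 (trv s t V) (tr (xV s) (\<lambda>k. shK (t k)) M (shK K)))"
    using r_beta by (simp add: tr_val, intro pRetb) auto
  then have "conv (tr s t (Wh M V) K) (tr (trv s t V \<cdot> s) t M K)" by (simp only: inst1_tr conv_pQ)
  with 1 show ?case using conv_sym by (meson rtranclp_trans)
next
  case (r_sub V M)
  have "pQ (tr s t (Wh M V) K) (inst1 (trv s t V) (tr (xV s) (\<lambda>k. shK (t k)) M (shK K)))"
    using r_sub by (simp add: tr_val, intro pRetb) auto
  then show ?case using r_sub by (simp only: inst1_tr tr_substT insV_0 conv_pQ)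
next
  case (r_mu M J)
  have "setK 0 s (liftK 0 M) (K \<cdot> t) = KL (tr (xV s) (\<lambda>k. shK (t k)) M (shK K)) \<cdot> t"
    by (rule ext, case_tac x; simp add: setK_def tr_lift)
  then have "tr s t (Wh M (Mu J)) K = tr s t (Mu (sstj 0 (liftK 0 M) J)) K"
    by (simp add: tr_sst)
  then show ?case by simp
next
  case (r_ren l J)
  have "(\<lambda>i. t (rnm 0 l i)) = t l \<cdot> t" by (rule ext, case_tac i; simp add: rnm_def)
  then have "trj s t (Jmp l (Mu J)) = trj s t (renKj 0 l J)" by (simp add: tr_renK)
  then show ?case by simp
next
  case (r_eta V)
  have "trv s t (Lam (App (liftT 0 V) (Var 0))) = VL (Cal (sh2V (trv s t V)) (VV 0) (KV 0))"
    using r_eta by (simp add: tr_lift rn_trv lV_def)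
  moreover have "pV \<dots> (trv s t V)" by (intro pVeta) auto
  ultimately have "pQ (Ret K (trv s t (Lam (App (liftT 0 V) (Var 0))))) (Ret K (trv s t V))"
    by (simp only: pRet p_refl)
  then have "pQ (tr s t (Lam (App (liftT 0 V) (Var 0))) K) (tr s t V K)"
    using r_eta by (simp only: tr_val is_val.simps)
  then show ?case by blast
next
  case (r_var M)
  have "pK (KL (tr (xV s) (\<lambda>k. shK (t k)) (Var 0) (shK K))) K"
    by (simp add: xV_def) (intro pKeta p_refl)
  then have "pQ (tr s t (Wh (Var 0) M) K) (tr s t M K)" by (simp only: tr.simps(4)) (intro p_tr p_refl)
  then show ?case by blast
next
  case (r_muk M)
  have "tr s t (Mu (Jmp 0 (liftK 0 M))) K = tr s t M K" by (simp add: tr_lift)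
  then show ?case by simp
next
  case (rLam m n)
  show ?case by (simp, rule conv_map[where f="\<lambda>q. Ret K (VL q)", OF rLam(2)]) (intro pRet pVL p_refl)
next
  case (rApp1 m m' n)
  then show ?case by (intro tr_App_congr) auto
next
  case (rApp2 n n' m)
  then show ?case by (intro tr_App_congr) auto
next
  case (rWh1 m m' n)
  show ?case by (simp, rule conv_map[where f="\<lambda>q. tr s t n (KL q)", OF rWh1(2)]) (intro p_tr pKL p_refl)
next
  case (rJWh1 i j n)
  show ?case by (simp, rule conv_map[where f="\<lambda>q. tr s t n (KL q)", OF rJWh1(2)]) (intro p_tr pKL p_refl)
qed simp_all

lemma ccv_eq_sound: "ccv_eq a b \<Longrightarrow> conv (tr s t a K) (tr s t b K)"
  unfolding ccv_eq_def
proof (induct rule: rtranclp_induct)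
  case (step y z)
  from step(2) have "conv (tr s t y K) (tr s t z K)"
    by (elim disjE) (auto simp: eqT_sound(1) intro: redT_sound(1) conv_sym)
  with step(3) show ?case by (meson rtranclp_trans)
qed simp

section \<open>Operations on source terms\<close>

lemma liftT_liftT:
  "i \<le> c \<Longrightarrow> liftT (Suc c) (liftT i m) = liftT i (liftT c m)"
  "i \<le> c \<Longrightarrow> liftTj (Suc c) (liftTj i j) = liftTj i (liftTj c j)"
  by (induct m and j arbitrary: i c and i c) auto

lemma liftK_liftK:
  "i \<le> c \<Longrightarrow> liftK (Suc c) (liftK i m) = liftK i (liftK c m)"
  "i \<le> c \<Longrightarrow> liftKj (Suc c) (liftKj i j) = liftKj i (liftKj c j)"
  by (induct m and j arbitrary: i c and i c) auto

lemma liftK_liftT: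
  "liftK c (liftT i m) = liftT i (liftK c m)"
  "liftKj c (liftTj i j) = liftTj i (liftKj c j)"
  by (induct m and j arbitrary: i c and i c) auto

lemma substT_liftT:
  "i \<le> n \<Longrightarrow> substT (Suc n) (liftT i V) (liftT i m) = liftT i (substT n V m)"
  "i \<le> n \<Longrightarrow> substTj (Suc n) (liftT i V) (liftTj i j) = liftTj i (substTj n V j)"
proof (induct m and j arbitrary: i n V and i n V)
  case (Var k)
  then show ?case by (cases k) auto
qed (auto simp: liftK_liftT simp flip: liftT_liftT(1)[of 0])

lemma substT_liftT_cancel:
  "substT n V (liftT n m) = m"
  "substTj n V (liftTj n j) = j"
  by (induct m and j arbitrary: n V and n V) auto

lemma substT_liftK:
  "substT n (liftK c V) (liftK c m) = liftK c (substT n V m)"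
  "substTj n (liftK c V) (liftKj c j) = liftKj c (substTj n V j)"
proof (induct m and j arbitrary: n c V and n c V)
  case (Mu j)
  have "liftK 0 (liftK c V) = liftK (Suc c) (liftK 0 V)" by (simp add: liftK_liftK)
  then show ?case by (simp add: Mu)
qed (auto simp flip: liftK_liftT)

lemma sst_liftT:
  "sst c (liftT (Suc i) L) (liftT i m) = liftT i (sst c L m)"
  "sstj c (liftT (Suc i) L) (liftTj i j) = liftTj i (sstj c L j)"
proof (induct m and j arbitrary: i c L and i c L)
qed (auto simp: liftK_liftT simp flip: liftT_liftT(1)[of "Suc 0"])

lemma sst_liftK:
  "i \<le> c \<Longrightarrow> sst (Suc c) (liftK i L) (liftK i m) = liftK i (sst c L m)"
  "i \<le> c \<Longrightarrow> sstj (Suc c) (liftK i L) (liftKj i j) = liftKj i (sstj c L j)"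
proof (induct m and j arbitrary: i c L and i c L)
qed (auto simp flip: liftK_liftT liftK_liftK(1)[of 0])

lemma sst_liftK_cancel:
  "sst c L (liftK c m) = liftK c m"
  "sstj c L (liftKj c j) = liftKj c j"
  by (induct m and j arbitrary: c L and c L) auto

lemma renK_liftT:
  "renK c l (liftT i m) = liftT i (renK c l m)"
  "renKj c l (liftTj i j) = liftTj i (renKj c l j)"
  by (induct m and j arbitrary: i c l and i c l) auto

lemma renK_liftK:
  "i \<le> c \<Longrightarrow> i \<le> l \<Longrightarrow> renK (Suc c) (Suc l) (liftK i m) = liftK i (renK c l m)"
  "i \<le> c \<Longrightarrow> i \<le> l \<Longrightarrow> renKj (Suc c) (Suc l) (liftKj i j) = liftKj i (renKj c l j)"
  by (induct m and j arbitrary: i c l and i c l) auto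

lemma renK_liftK_cancel:
  "renK c l (liftK c m) = m"
  "renKj c l (liftKj c j) = j"
  by (induct m and j arbitrary: c l and c l) auto

text \<open>By (E3) every jump is congruent to one of the form \<open>[k]M\<close>;
  \<open>tail\<close> gives \<open>k\<close> and \<open>body\<close> gives \<open>M\<close>.\<close>

primrec tail :: "jmp \<Rightarrow> nat" where
  "tail (Jmp k m) = k"
| "tail (JWh j m) = tail j"

primrec body :: "jmp \<Rightarrow> trm" where
  "body (Jmp k m) = m"
| "body (JWh j m) = Wh (body j) m"

lemma eqJ_Jmp_body: "eqJ j (Jmp (tail j) (body j))"
proof (induct j rule: jmp.induct[where ?P1.0="\<lambda>_. True"])
  case (JWh j m)
  then have "eqJ (JWh j m) (JWh (Jmp (tail j) (body j)) m)" by (auto intro: cJWh reflT)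
  then show ?case by (simp, meson transJ symJ E3)
qed (auto intro: reflJ)

text \<open>\<open>body\<close> turns (E3) into an identity and the jump form of (E1) into (E1). So
  congruences of jumps carry over to readbacks whose \<mu> has been contracted.\<close>

lemma eqJ_body:
  "eqJ i j \<Longrightarrow> tail i = tail j \<and> eqT (body i) (body j)"
proof (induct rule: eqT_eqJ.inducts(2)[where ?P1.0="\<lambda>_ _. True"])
  case (E1j J M N)
  have "body (liftTj c J) = liftT c (body J)" "tail (liftTj c J) = tail J" for c
    by (induct J arbitrary: c rule: jmp.induct[where ?P1.0="\<lambda>_. True"]) auto
  then show ?case by (simp add: E1[simplified])
qed (auto intro: eqT_eqJ.intros)

lemma body_ops [simp]:
  "body (liftTj c j) = liftT c (body j)" "tail (liftTj c j) = tail j"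
  "body (liftKj c j) = liftK c (body j)" "tail (liftKj c j) = shift c (tail j)"
  "body (substTj c V j) = substT c V (body j)" "tail (substTj c V j) = tail j"
  "body (renKj c l j) = renK c l (body j)" "tail (renKj c l j) = rnm c l (tail j)"
  by (induct j arbitrary: c V rule: jmp.induct[where ?P1.0="\<lambda>_. True"]) (auto simp: shift_def rnm_def)

lemma body_sstj: "tail j \<noteq> c \<Longrightarrow> body (sstj c L j) = sst c L (body j)"
  by (induct j arbitrary: L rule: jmp.induct[where ?P1.0="\<lambda>_. True"]) auto

section \<open>Readback\<close>

text \<open>The source jumps with a hole \<open>[k]\<box>\<close> and \<open>(J where x := \<box>)\<close>.\<close>

datatype sk = SV nat | SL jmp

primrec plug :: "sk \<Rightarrow> trm \<Rightarrow> jmp" where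
  "plug (SV k) m = Jmp k m"
| "plug (SL j) m = JWh j m"

primrec liftTs :: "nat \<Rightarrow> sk \<Rightarrow> sk" where
  "liftTs c (SV k) = SV k"
| "liftTs c (SL j) = SL (liftTj (Suc c) j)"

primrec liftKs :: "nat \<Rightarrow> sk \<Rightarrow> sk" where
  "liftKs c (SV k) = SV (shift c k)"
| "liftKs c (SL j) = SL (liftKj c j)"

primrec substs :: "nat \<Rightarrow> trm \<Rightarrow> sk \<Rightarrow> sk" where
  "substs n V (SV k) = SV k"
| "substs n V (SL j) = SL (substTj (Suc n) (liftT 0 V) j)"

primrec renKs :: "nat \<Rightarrow> nat \<Rightarrow> sk \<Rightarrow> sk" where
  "renKs c l (SV k) = SV (rnm c l k)"
| "renKs c l (SL j) = SL (renKj c l j)"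

text \<open>Structural substitution sends \<open>[c]\<box>\<close> to
  \<open>[c](L where x := \<box>)\<close>. As a member of \<open>sk\<close> this has to be written
  \<open>([c]L where x := \<box>)\<close>, so \<open>plug_sst\<close> holds up to (E3) and not as an
  equation.\<close>

primrec ssts :: "nat \<Rightarrow> trm \<Rightarrow> sk \<Rightarrow> sk" where
  "ssts c L (SV k) = (if k = c then SL (Jmp c L) else SV k)"
| "ssts c L (SL j) = SL (sstj c (liftT 1 L) j)"

lemma plug_ops:
  "liftTj c (plug s m) = plug (liftTs c s) (liftT c m)"
  "liftKj c (plug s m) = plug (liftKs c s) (liftK c m)"
  "substTj c V (plug s m) = plug (substs c V s) (substT c V m)"
  "renKj c l (plug s m) = plug (renKs c l s) (renK c l m)"
  by (cases s; simp add: shift_def rnm_def)+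

lemma plug_sst: "eqJ (sstj c L (plug s m)) (plug (ssts c L s) (sst c L m))"
  by (cases s) (auto intro: reflJ E3)

lemma sk_commute:
  "liftTs (Suc c) (liftTs 0 s) = liftTs 0 (liftTs c s)"
  "liftKs (Suc c) (liftKs 0 s) = liftKs 0 (liftKs c s)"
  "liftKs c (liftTs i s) = liftTs i (liftKs c s)"
  "substs (Suc n) (liftT 0 V) (liftTs 0 s) = liftTs 0 (substs n V s)"
  "substs n (liftK 0 V) (liftKs 0 s) = liftKs 0 (substs n V s)"
  "renKs c l (liftTs i s) = liftTs i (renKs c l s)"
  "renKs (Suc c) (Suc l) (liftKs 0 s) = liftKs 0 (renKs c l s)"
  "renKs 0 l (liftKs 0 s) = s"
  "ssts c (liftT 1 L) (liftTs 0 s) = liftTs 0 (ssts c L s)"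
  "ssts (Suc c) (liftK 0 L) (liftKs 0 s) = liftKs 0 (ssts c L s)"
  "ssts 0 L (liftKs 0 s) = liftKs 0 s"
  using substT_liftT(2)[of 1 "Suc n" "liftT 0 V"] sst_liftT(2)[of c 1 "liftT 1 L"]
  by (cases s; simp add: liftT_liftT liftK_liftK liftK_liftT renK_liftT renK_liftK renK_liftK_cancel
        sst_liftK sst_liftK_cancel substT_liftK shift_def rnm_def flip: liftK_liftT(1))+

text \<open>Continuation 0 occurs exactly once, namely in tail position. Such a command is read back as
a term without the binder: \<open>body\<close> contracts \<open>\<mu>k.[k]M\<close> to \<open>M\<close> on the fly. The index \<open>SV 0\<close> given to
the tail variable in this case is a dummy that \<open>body\<close> discards.\<close>

primrec linQ :: "cmd \<Rightarrow> bool" and linK :: "kon \<Rightarrow> bool" where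
  "linQ (Ret K W) = (linK K \<and> \<not> ockV 0 W)"
| "linQ (Cal V W K) = (linK K \<and> \<not> ockV 0 V \<and> \<not> ockV 0 W)"
| "linK (KV k) = (k = 0)"
| "linK (KL Q) = linQ Q"

definition upT :: "(nat \<Rightarrow> trm) \<Rightarrow> nat \<Rightarrow> trm" where
  "upT x = Var 0 \<cdot> (\<lambda>i. liftT 0 (x i))"

text \<open>In the linear branch of \<open>VL\<close> no \<mu> is introduced, hence the other
  continuations are lifted past the new ordinary variable only; \<open>liftKs\<close> appears just
  in the branch that produces a \<open>Mu\<close>.\<close>

primrec rv :: "(nat \<Rightarrow> trm) \<Rightarrow> (nat \<Rightarrow> sk) \<Rightarrow> val \<Rightarrow> trm"
    and rj :: "(nat \<Rightarrow> trm) \<Rightarrow> (nat \<Rightarrow> sk) \<Rightarrow> cmd \<Rightarrow> jmp"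
    and rk :: "(nat \<Rightarrow> trm) \<Rightarrow> (nat \<Rightarrow> sk) \<Rightarrow> kon \<Rightarrow> sk" where
  "rv x e (VV i) = x i"
| "rv x e (VL Q) = Lam
    (if linQ Q then body (rj (upT x) (SV 0 \<cdot> (\<lambda>k. liftTs 0 (e k))) Q)
     else Mu (rj (\<lambda>i. liftK 0 (upT x i)) (SV 0 \<cdot> (\<lambda>k. liftKs 0 (liftTs 0 (e k)))) Q))"
| "rj x e (Ret K W) = plug (rk x e K) (rv x e W)"
| "rj x e (Cal V W K) = plug (rk x e K) (App (rv x e V) (rv x e W))"
| "rk x e (KV k) = e k"
| "rk x e (KL Q) = SL (rj (upT x) (\<lambda>k. liftTs 0 (e k)) Q)"


text \<open>Reads a command as a term, with continuation 0 as its return point. Bodies of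
  abstractions and whole programs are read in this way.\<close>

definition rm :: "(nat \<Rightarrow> trm) \<Rightarrow> (nat \<Rightarrow> sk) \<Rightarrow> cmd \<Rightarrow> trm" where
  "rm x e Q = (if linQ Q then body (rj x (SV 0 \<cdot> e) Q)
     else Mu (rj (\<lambda>i. liftK 0 (x i)) (SV 0 \<cdot> (\<lambda>k. liftKs 0 (e k))) Q))"

lemma rv_VL: "rv x e (VL Q) = Lam (rm (upT x) (\<lambda>k. liftTs 0 (e k)) Q)"
  by (simp add: rm_def)

lemma upT_env:
  "(\<lambda>i. liftT (Suc c) (upT x i)) = upT (\<lambda>i. liftT c (x i))"
  "(\<lambda>i. liftK c (upT x i)) = upT (\<lambda>i. liftK c (x i))"
  "(\<lambda>i. substT (Suc n) (liftT 0 V) (upT x i)) = upT (\<lambda>i. substT n V (x i))"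
  "upT Var = Var"
  "(\<lambda>i. upT x (up r i)) = upT (\<lambda>i. x (r i))"
  unfolding upT_def
  by (simp_all add: comp_scons liftT_liftT liftK_liftT substT_liftT up_def) (rule scons_eqI; simp)

lemma rj_cong:
  "(\<And>k. ockV k v \<Longrightarrow> e k = e' k) \<Longrightarrow> rv x e v = rv x e' v"
  "(\<And>k. ockQ k q \<Longrightarrow> e k = e' k) \<Longrightarrow> rj x e q = rj x e' q"
  "(\<And>l. ockK l k \<Longrightarrow> e l = e' l) \<Longrightarrow> rk x e k = rk x e' k"
proof (induct v and q and k arbitrary: x e e' and x e e' and x e e')
  case (VL q)
  have "rj x (SV 0 \<cdot> (\<lambda>k. f (e k))) q = rj x (SV 0 \<cdot> (\<lambda>k. f (e' k))) q" for x f
    by (rule VL.hyps, case_tac k) (simp_all add: VL.prems)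
  from this[where f="liftTs 0"] this[where f="\<lambda>k. liftKs 0 (liftTs 0 k)"]
  show ?case by simp
next
  case (Ret k v)
  show ?case by (simp, intro arg_cong2[where f=plug] Ret.hyps; simp add: Ret.prems)
next
  case (Cal v w k)
  show ?case by (simp, intro arg_cong2[where f=plug] arg_cong2[where f=App] Cal.hyps; simp add: Cal.prems)
next
  case (KL q)
  show ?case by (simp, intro KL.hyps; simp add: KL.prems)
qed simp_all

text \<open>Linearity never descends into values, so facts about it need an induction over commands
  and continuations only.\<close>

lemma cmd_kon_induct [case_names Ret Cal KV KL]:
  assumes "\<And>k v. P2 k \<Longrightarrow> P1 (Ret k v)" "\<And>v w k. P2 k \<Longrightarrow> P1 (Cal v w k)"
    "\<And>k. P2 (KV k)" "\<And>q. P1 q \<Longrightarrow> P2 (KL q)"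
  shows "P1 q" "P2 k"
  using assms val_cmd_kon.induct[of "\<lambda>_. True" P1 P2] by blast+

lemma rv_scons_cong: "\<not> ockV 0 v \<Longrightarrow> rv x (a \<cdot> e) v = rv x (b \<cdot> e) v"
  by (rule rj_cong, case_tac k) auto

text \<open>In a linear command continuation 0 is used only at the tail, which is what
  \<open>body\<close> discards. The freedom to change the dummy is needed because lifting and
  renaming move it.\<close>

lemma lin_body:
  "linQ q \<Longrightarrow> body (rj x (SV a \<cdot> e) q) = body (rj x (SV b \<cdot> e) q)"
  "linK k \<Longrightarrow> body (plug (rk x (SV a \<cdot> e) k) m) = body (plug (rk x (SV b \<cdot> e) k) m)"
proof (induct q and k arbitrary: x e and x e m rule: cmd_kon_induct)
  case (Ret k v)
  then show ?case by (simp add: rv_scons_cong[where a="SV a" and b="SV b"])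
next
  case (Cal v w k)
  then show ?case by (simp add: rv_scons_cong[where a="SV a" and b="SV b"])
qed (simp_all add: comp_scons)

lemma lin_tail:
  "linQ q \<Longrightarrow> tail (rj x (SV a \<cdot> e) q) = a"
  "linK k \<Longrightarrow> tail (plug (rk x (SV a \<cdot> e) k) m) = a"
  by (induct q and k arbitrary: x e and x e m rule: cmd_kon_induct) (simp_all add: comp_scons)

section \<open>The readback commutes with the source operations\<close>

lemma liftT_rj:
  "liftT c (rv x e v) = rv (\<lambda>i. liftT c (x i)) (\<lambda>k. liftTs c (e k)) v"
  "liftTj c (rj x e q) = rj (\<lambda>i. liftT c (x i)) (\<lambda>k. liftTs c (e k)) q"
  "liftTs c (rk x e k) = rk (\<lambda>i. liftT c (x i)) (\<lambda>k. liftTs c (e k)) k"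
proof (induct v and q and k arbitrary: c x e and c x e and c x e)
  case (VL q)
  have "liftT c (body (rj x e q)) = body (rj (\<lambda>i. liftT c (x i)) (\<lambda>k. liftTs c (e k)) q)" for c x e
    using arg_cong[OF VL, of body] by simp
  then show ?case by (simp add: VL comp_scons upT_env sk_commute liftK_liftT)
qed (simp_all add: plug_ops comp_scons upT_env sk_commute)

lemma liftK_rj:
  "liftK c (rv x e v) = rv (\<lambda>i. liftK c (x i)) (\<lambda>k. liftKs c (e k)) v"
  "liftKj c (rj x e q) = rj (\<lambda>i. liftK c (x i)) (\<lambda>k. liftKs c (e k)) q"
  "liftKs c (rk x e k) = rk (\<lambda>i. liftK c (x i)) (\<lambda>k. liftKs c (e k)) k"
proof (induct v and q and k arbitrary: c x e and c x e and c x e)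
  case (VL q)
  have "liftK c (body (rj x (SV 0 \<cdot> e) q)) = body (rj (\<lambda>i. liftK c (x i)) (SV 0 \<cdot> (\<lambda>k. liftKs c (e k))) q)"
    if "linQ q" for c x e
    using arg_cong[OF VL[of c x "SV 0 \<cdot> e"], of body] lin_body(1)[OF that, of _ "shift c 0" _ 0]
    by (simp add: comp_scons)
  then show ?case by (simp add: VL comp_scons upT_env sk_commute liftK_liftK)
qed (simp_all add: plug_ops comp_scons upT_env sk_commute)

lemma substT_rj:
  "substT c V (rv x e v) = rv (\<lambda>i. substT c V (x i)) (\<lambda>k. substs c V (e k)) v"
  "substTj c V (rj x e q) = rj (\<lambda>i. substT c V (x i)) (\<lambda>k. substs c V (e k)) q"
  "substs c V (rk x e k) = rk (\<lambda>i. substT c V (x i)) (\<lambda>k. substs c V (e k)) k"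
proof (induct v and q and k arbitrary: c V x e and c V x e and c V x e)
  case (VL q)
  have "substT c V (body (rj x e q)) = body (rj (\<lambda>i. substT c V (x i)) (\<lambda>k. substs c V (e k)) q)" for c V x e
    using arg_cong[OF VL, of body] by simp
  moreover have "liftK 0 (liftT 0 V) = liftT 0 (liftK 0 V)" by (simp add: liftK_liftT)
  ultimately show ?case by (simp add: VL comp_scons upT_env sk_commute substT_liftK)
qed (simp_all add: plug_ops comp_scons upT_env sk_commute)

lemma renK_rj:
  "renK c l (rv Var e v) = rv Var (\<lambda>k. renKs c l (e k)) v"
  "renKj c l (rj Var e q) = rj Var (\<lambda>k. renKs c l (e k)) q"
  "renKs c l (rk Var e k) = rk Var (\<lambda>k. renKs c l (e k)) k"
proof (induct v and q and k arbitrary: c l e and c l e and c l e)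
  case (VL q)
  have "renK c l (body (rj Var (SV 0 \<cdot> e) q)) = body (rj Var (SV 0 \<cdot> (\<lambda>k. renKs c l (e k))) q)"
    if "linQ q" for c l e
    using arg_cong[OF VL[of c l "SV 0 \<cdot> e"], of body] lin_body(1)[OF that, of _ "rnm c l 0" _ 0]
    by (simp add: comp_scons)
  moreover have "rnm (Suc c) (Suc l) 0 = 0" by (simp add: rnm_def)
  ultimately show ?case by (simp add: VL comp_scons upT_env sk_commute)
qed (simp_all add: plug_ops comp_scons upT_env sk_commute)

definition eqS :: "sk \<Rightarrow> sk \<Rightarrow> bool" where
  "eqS s s' \<longleftrightarrow> s = s' \<or> (\<exists>j j'. s = SL j \<and> s' = SL j' \<and> eqJ j j')"

lemma eqS_refl [simp, intro]: "eqS s s" by (simp add: eqS_def)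

lemma eqS_SL [intro]: "eqJ j j' \<Longrightarrow> eqS (SL j) (SL j')" by (simp add: eqS_def)

lemma plug_cong: "eqS s s' \<Longrightarrow> eqT m m' \<Longrightarrow> eqJ (plug s m) (plug s' m')"
  unfolding eqS_def by (cases s) (auto intro!: cJmp cJWh reflJ)

lemma sst_rj:
  "eqT (sst c L (rv Var e v)) (rv Var (\<lambda>k. ssts c L (e k)) v)"
  "eqJ (sstj c L (rj Var e q)) (rj Var (\<lambda>k. ssts c L (e k)) q)"
  "eqS (ssts c L (rk Var e k)) (rk Var (\<lambda>k. ssts c L (e k)) k)"
proof (induct v and q and k arbitrary: c L e and c L e and c L e)
  case (VL q)
  have "eqT (sst c L (body (rj Var (SV 0 \<cdot> e) q))) (body (rj Var (SV 0 \<cdot> (\<lambda>k. ssts c L (e k))) q))"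
    if "linQ q" for c L e
    \<comment> \<open>The dummy tail is taken to be \<open>Suc c\<close>, an index different from
      \<open>c\<close>: structural substitution at \<open>c\<close> then leaves the tail alone, as
      \<open>body_sstj\<close> requires.\<close>
    using eqJ_body[OF VL[of c L "SV (Suc c) \<cdot> e"]] lin_body(1)[OF that, of _ "Suc c" _ 0] lin_tail(1)[OF that]
    by (simp add: comp_scons body_sstj)
  note lin = this[of c "liftT 1 L" "\<lambda>k. liftTs 0 (e k)"]
  have nonlin: "eqJ (sstj (Suc c) (liftK 0 (liftT 1 L)) (rj Var (SV 0 \<cdot> (\<lambda>k. liftKs 0 (liftTs 0 (e k)))) q))
     (rj Var (SV 0 \<cdot> (\<lambda>k. liftKs 0 (liftTs 0 (ssts c L (e k))))) q)"
    using VL[of "Suc c" "liftK 0 (liftT 1 L)" "SV 0 \<cdot> (\<lambda>k. liftKs 0 (liftTs 0 (e k)))"]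
    by (simp add: comp_scons sk_commute(9,10)[simplified])
  show ?case using lin nonlin by (auto simp: upT_env sk_commute(9)[simplified] intro!: cLam cMu)
next
  case (Ret k v)
  then show ?case by (simp, meson plug_sst plug_cong transJ)
next
  case (Cal v w k)
  then have "eqT (sst c L (App (rv Var e v) (rv Var e w))) (App (rv Var (\<lambda>k. ssts c L (e k)) v) (rv Var (\<lambda>k. ssts c L (e k)) w))"
    by (simp add: cApp)
  with Cal(3) show ?case by (simp only: rj.simps) (meson plug_sst plug_cong transJ)
next
  case (KL q)
  then show ?case using KL[of c "liftT 1 L" "\<lambda>k. liftTs 0 (e k)"]
    by (auto simp add: upT_env sk_commute(9)[simplified])
qed (auto intro: reflT)


section \<open>Linearity and readback under target substitution\<close>

lemma ockV_sb_conv: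
  "ockV k v \<Longrightarrow> ockK n (t k) \<Longrightarrow> ockV n (sbV s t v)"
  "ockQ k q \<Longrightarrow> ockK n (t k) \<Longrightarrow> ockQ n (sbQ s t q)"
  "ockK k K \<Longrightarrow> ockK n (t k) \<Longrightarrow> ockK n (sbK s t K)"
  by (induct v and q and K arbitrary: k n s t and k n s t and k n s t)
     (auto simp: lK_def ock_rn)

lemma lin_ock:
  "linQ q \<Longrightarrow> ockQ 0 q" "linK k \<Longrightarrow> ockK 0 k"
  by (induct q and k rule: cmd_kon_induct) auto

lemma lin_rn:
  assumes "\<And>k. c k = 0 \<longleftrightarrow> k = 0"
  shows "linQ (rnQ r c q) = linQ q" "linK (rnK r c k) = linK k"
proof (induct q and k arbitrary: r and r rule: cmd_kon_induct)
  have pos: "0 < c i \<longleftrightarrow> 0 < i" for i using assms[of i] by auto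
  {
    case (Ret k v)
    then show ?case by (simp add: ock_rn pos) (metis gr0I less_irrefl)
  next
    case (Cal v w k)
    then show ?case by (simp add: ock_rn pos) (metis gr0I less_irrefl)
  }
qed (simp_all add: assms)

lemma ock_env:
  "(\<And>i. \<not> ockV n (s i)) \<Longrightarrow> \<not> ockV n (xV s i)"
  by (cases i) (auto simp: xV_def ock_rn)

text \<open>The guard on \<open>Suc k\<close> is there for the instantiation
  \<open>k \<cdot> KV\<close>, which maps index 1 to \<open>KV 0\<close>. In
  \<open>reds_body_plug_rm\<close> that index does not occur, and only then is the tail of the
  plugged continuation the sole use of continuation 0.\<close>

lemma lin_sb_imp:
  "linQ q \<Longrightarrow> (\<And>i. \<not> ockV 0 (s i)) \<Longrightarrow> linK (t 0) \<Longrightarrow> (\<And>k. ockQ (Suc k) q \<Longrightarrow> \<not> ockK 0 (t (Suc k)))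
    \<Longrightarrow> linQ (sbQ s t q)"
  "linK k \<Longrightarrow> (\<And>i. \<not> ockV 0 (s i)) \<Longrightarrow> linK (t 0) \<Longrightarrow> (\<And>l. ockK (Suc l) k \<Longrightarrow> \<not> ockK 0 (t (Suc l)))
    \<Longrightarrow> linK (sbK s t k)"
proof (induct q and k arbitrary: s t and s t rule: cmd_kon_induct)
  case (Ret k v)
  have "\<not> ockV 0 (sbV s t v)"
    using ock_sb(1)[of 0 s t v] Ret.prems by (metis linQ.simps(1) not0_implies_Suc ockQ.simps(1))
  then show ?case using Ret by auto
next
  case (Cal v w k)
  have "\<not> ockV 0 (sbV s t v)" "\<not> ockV 0 (sbV s t w)"
    using ock_sb(1)[of 0 s t v] ock_sb(1)[of 0 s t w] Cal.prems by (metis linQ.simps(2) not0_implies_Suc ockQ.simps(2))+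
  then show ?case using Cal by auto
next
  case (KL q)
  then show ?case by (simp, intro KL.hyps) (auto simp: ock_env ock_rn lin_rn)
qed auto

lemma lin_sb_rev:
  "linQ (sbQ s t q) \<Longrightarrow> t 0 = KV 0 \<Longrightarrow> (\<And>k. \<not> ockK 0 (t (Suc k))) \<Longrightarrow> linQ q"
  "linK (sbK s t k) \<Longrightarrow> t 0 = KV 0 \<Longrightarrow> (\<And>k. \<not> ockK 0 (t (Suc k))) \<Longrightarrow> linK k"
proof (induct q and k arbitrary: s t and s t rule: cmd_kon_induct)
  case (KV k)
  then show ?case using lin_ock(2) by (cases k) auto
next
  case (KL q)
  show ?case
    using KL.prems by (simp, intro KL.hyps[of "xV s" "\<lambda>k. shK (t k)"]) (auto simp: ock_rn)
next
  case (Ret k v)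
  then show ?case using ockV_sb_conv(1)[of 0 v 0 t s] by auto
next
  case (Cal v w k)
  then show ?case using ockV_sb_conv(1)[of 0 v 0 t s] ockV_sb_conv(1)[of 0 w 0 t s] by auto
qed

lemma lin_sb:
  assumes "\<And>i. \<not> ockV 0 (s i)" "t 0 = KV 0" "\<And>k. \<not> ockK 0 (t (Suc k))"
  shows "linQ (sbQ s t q) = linQ q"
  using assms lin_sb_imp(1)[of q s t] lin_sb_rev(1)[of s t q] by auto

lemma lin_sb_up: "linQ (sbQ (lV s) (lK t) q) = linQ q"
  by (rule lin_sb, case_tac i) (auto simp: lV_def lK_def ock_rn)

lemma rj_rn:
  "rv x e (rnV r c v) = rv (\<lambda>i. x (r i)) (\<lambda>k. e (c k)) v"
  "rj x e (rnQ r c q) = rj (\<lambda>i. x (r i)) (\<lambda>k. e (c k)) q"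
  "rk x e (rnK r c k) = rk (\<lambda>i. x (r i)) (\<lambda>k. e (c k)) k"
proof (induct v and q and k arbitrary: x e r c and x e r c and x e r c)
  case (VL q)
  have "linQ (rnQ (up r) (up c) q) = linQ q"
    by (rule lin_rn, case_tac k) auto
  moreover have "(\<lambda>k. (s \<cdot> f) (up c k)) = s \<cdot> (\<lambda>k. f (c k))" for s and f :: "nat \<Rightarrow> sk"
    by (simp add: up_def comp_scons)
  ultimately show ?case by (simp add: VL upT_env)
qed (simp_all add: upT_env)

lemma rj_sb:
  "rv x e (sbV s t v) = rv (\<lambda>i. rv x e (s i)) (\<lambda>k. rk x e (t k)) v"
  "rj x e (sbQ s t q) = rj (\<lambda>i. rv x e (s i)) (\<lambda>k. rk x e (t k)) q"
  "rk x e (sbK s t k) = rk (\<lambda>i. rv x e (s i)) (\<lambda>k. rk x e (t k)) k"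
proof (induct v and q and k arbitrary: x e s t and x e s t and x e s t)
  case (VL q)
  show ?case
    by (simp add: VL upT_env lin_sb_up)
       (simp add: upT_def lV_def lK_def comp_scons rj_rn liftT_rj liftK_rj liftK_liftT sk_commute)
next
  case (KL q)
  show ?case
    by (simp add: KL) (simp add: upT_def xV_def comp_scons rj_rn liftT_rj)
qed simp_all

section \<open>Congruences between readbacks\<close>

lemma eqT_liftT:
  "eqT a b \<Longrightarrow> eqT (liftT c a) (liftT c b)"
  "eqJ i j \<Longrightarrow> eqJ (liftTj c i) (liftTj c j)"
proof (induct arbitrary: c and c rule: eqT_eqJ.inducts)
  case (E1 L M N)
  have "liftT (Suc (Suc c)) (liftT 1 L) = liftT 1 (liftT (Suc c) L)" by (rule liftT_liftT) simp
  then show ?case by (simp add: eqT_eqJ.E1[simplified])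
next
  case (E1j L M N)
  have "liftTj (Suc (Suc c)) (liftTj 1 L) = liftTj 1 (liftTj (Suc c) L)" by (rule liftT_liftT) simp
  then show ?case by (simp add: eqT_eqJ.E1j[simplified])
next
  case (E2 J M)
  show ?case by (simp add: eqT_eqJ.E2 flip: liftK_liftT)
qed (auto intro: eqT_eqJ.intros)

lemma eqT_liftK:
  "eqT a b \<Longrightarrow> eqT (liftK c a) (liftK c b)"
  "eqJ i j \<Longrightarrow> eqJ (liftKj c i) (liftKj c j)"
proof (induct arbitrary: c and c rule: eqT_eqJ.inducts)
  case (E1 L M N)
  show ?case by (simp add: eqT_eqJ.E1[simplified] liftK_liftT)
next
  case (E1j L M N)
  show ?case by (simp add: eqT_eqJ.E1j[simplified] liftK_liftT)
next
  case (E2 J M)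
  show ?case by (simp add: eqT_eqJ.E2 liftK_liftK)
qed (auto intro: eqT_eqJ.intros)

lemma eqS_lift: "eqS s s' \<Longrightarrow> eqS (liftTs c s) (liftTs c s')" "eqS s s' \<Longrightarrow> eqS (liftKs c s) (liftKs c s')"
  unfolding eqS_def by (auto intro: eqT_liftT eqT_liftK)

lemma eqS_scons: "eqS a b \<Longrightarrow> (\<And>k. eqS (e k) (e' k)) \<Longrightarrow> eqS ((a \<cdot> e) k) ((b \<cdot> e') k)"
  by (cases k) auto

lemma eqS_rj:
  "(\<And>k. eqS (e k) (e' k)) \<Longrightarrow> eqT (rv x e v) (rv x e' v)"
  "(\<And>k. eqS (e k) (e' k)) \<Longrightarrow> eqJ (rj x e q) (rj x e' q)"
  "(\<And>k. eqS (e k) (e' k)) \<Longrightarrow> eqS (rk x e k) (rk x e' k)"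
proof (induct v and q and k arbitrary: x e e' and x e e' and x e e')
  case (VL q)
  have "eqJ (rj x (SV 0 \<cdot> (\<lambda>k. liftTs 0 (e k))) q) (rj x (SV 0 \<cdot> (\<lambda>k. liftTs 0 (e' k))) q)"
    "eqJ (rj x (SV 0 \<cdot> (\<lambda>k. liftKs 0 (liftTs 0 (e k)))) q) (rj x (SV 0 \<cdot> (\<lambda>k. liftKs 0 (liftTs 0 (e' k)))) q)" for x
    by (intro VL eqS_scons eqS_lift eqS_refl)+
  then show ?case by (auto intro!: cLam cMu dest: eqJ_body)
next
  case (KL q)
  then show ?case by (simp, intro eqS_SL KL.hyps eqS_lift)
qed (auto intro!: reflT plug_cong cApp)

text \<open>For the two forms of \<open>s\<close> this is (E3) and the jump form of (E1).\<close>

lemma plug_Wh: "eqJ (plug s (Wh b m)) (JWh (plug (liftTs 0 s) b) m)"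
  by (cases s) (simp_all add: E3 E1j[simplified])

text \<open>A linear command is read as a spine of \<open>where\<close>s, and \<open>plug_Wh\<close>
  lets \<open>s\<close> slide down this spine until it takes the place of the tail. Returning
  through a contracted \<mu> thus costs no reduction, only congruence.\<close>

lemma lin_plug:
  "linQ q \<Longrightarrow> eqJ (plug s (body (rj x (SV a \<cdot> e) q))) (rj x (s \<cdot> e) q)"
  "linK k \<Longrightarrow> eqJ (plug s (body (plug (rk x (SV a \<cdot> e) k) m))) (plug (rk x (s \<cdot> e) k) m)"
proof (induct q and k arbitrary: x e s and x e s m rule: cmd_kon_induct)
  case (Ret k v)
  then show ?case by (simp add: rv_scons_cong[where a="s" and b="SV a"])
next
  case (Cal v w k)
  then show ?case by (simp add: rv_scons_cong[where a="s" and b="SV a"])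
next
  case (KV k)
  then show ?case by (simp add: reflJ)
next
  case (KL q)
  have "eqJ (JWh (plug (liftTs 0 s) (body (rj (upT x) (SV a \<cdot> (\<lambda>k. liftTs 0 (e k))) q))) m)
    (JWh (rj (upT x) (liftTs 0 s \<cdot> (\<lambda>k. liftTs 0 (e k))) q) m)"
    using KL by (intro cJWh reflT) auto
  then show ?case by (simp add: comp_scons) (meson plug_Wh transJ)
qed

lemma liftK_body: "linQ q \<Longrightarrow>
  body (rj Var (SV 0 \<cdot> (\<lambda>k. liftKs 0 (e k))) q) = liftK 0 (body (rj Var (SV 0 \<cdot> e) q))"
  using arg_cong[OF liftK_rj(2)[of 0 Var "SV 0 \<cdot> e" q], of body] lin_body(1)[of q Var 1 _ 0]
  by (simp add: comp_scons)

section \<open>Simulation of target reductions\<close>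

definition redsJ :: "jmp \<Rightarrow> jmp \<Rightarrow> bool" where
  "redsJ = (\<lambda>a b. eqJ a b \<or> redJ a b)\<^sup>*\<^sup>*"

lemma reds_refl [simp, intro]: "reds a a" by (simp add: reds_def)
lemma redsJ_refl [simp, intro]: "redsJ a a" by (simp add: redsJ_def)
lemma reds_trans [trans]: "reds a b \<Longrightarrow> reds b c \<Longrightarrow> reds a c"
  unfolding reds_def by (rule rtranclp_trans)
lemma redsJ_trans [trans]: "redsJ a b \<Longrightarrow> redsJ b c \<Longrightarrow> redsJ a c"
  unfolding redsJ_def by (rule rtranclp_trans)
lemma eqT_reds: "eqT a b \<Longrightarrow> reds a b" unfolding reds_def by (rule r_into_rtranclp) simp
lemma redT_reds: "redT a b \<Longrightarrow> reds a b" unfolding reds_def by (rule r_into_rtranclp) simp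
lemma eqJ_redsJ: "eqJ a b \<Longrightarrow> redsJ a b" unfolding redsJ_def by (rule r_into_rtranclp) simp
lemma redJ_redsJ: "redJ a b \<Longrightarrow> redsJ a b" unfolding redsJ_def by (rule r_into_rtranclp) simp

lemma rtranclp_map:
  assumes "R\<^sup>*\<^sup>* a b" "\<And>a b. R a b \<Longrightarrow> S (f a) (f b)"
  shows "S\<^sup>*\<^sup>* (f a) (f b)"
  using assms(1) by (induct rule: rtranclp_induct) (auto intro: assms(2) rtranclp.rtrancl_into_rtrancl)

lemma reds_Lam: "reds a b \<Longrightarrow> reds (Lam a) (Lam b)"
  unfolding reds_def by (erule rtranclp_map) (auto intro: cLam rLam)
lemma reds_Mu: "redsJ a b \<Longrightarrow> reds (Mu a) (Mu b)"
  unfolding reds_def redsJ_def by (erule rtranclp_map) (auto intro: cMu rMu)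
lemma reds_Jmp: "reds a b \<Longrightarrow> redsJ (Jmp k a) (Jmp k b)"
  unfolding reds_def redsJ_def by (erule rtranclp_map) (auto intro: cJmp rJmp)

lemma reds_App: assumes "reds a b" "reds c d" shows "reds (App a c) (App b d)"
proof -
  have "reds (App a c) (App b c)"
    using assms(1) unfolding reds_def by (rule rtranclp_map[where f="\<lambda>x. App x c"]) (auto intro: cApp reflT rApp1)
  also have "reds (App b c) (App b d)"
    using assms(2) unfolding reds_def by (rule rtranclp_map) (auto intro: cApp reflT rApp2)
  finally show ?thesis .
qed

lemma reds_Wh: assumes "reds a b" "reds c d" shows "reds (Wh a c) (Wh b d)"
proof -
  have "reds (Wh a c) (Wh b c)"
    using assms(1) unfolding reds_def by (rule rtranclp_map[where f="\<lambda>x. Wh x c"]) (auto intro: cWh reflT rWh1)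
  also have "reds (Wh b c) (Wh b d)"
    using assms(2) unfolding reds_def by (rule rtranclp_map) (auto intro: cWh reflT rWh2)
  finally show ?thesis .
qed

lemma reds_JWh: assumes "redsJ a b" "reds c d" shows "redsJ (JWh a c) (JWh b d)"
proof -
  have "redsJ (JWh a c) (JWh b c)"
    using assms(1) unfolding redsJ_def by (rule rtranclp_map[where f="\<lambda>x. JWh x c"]) (auto intro: cJWh reflT rJWh1)
  also have "redsJ (JWh b c) (JWh b d)"
    using assms(2) unfolding reds_def redsJ_def by (rule rtranclp_map) (auto intro: cJWh reflJ rJWh2)
  finally show ?thesis .
qed

lemma reds_plug: "reds m m' \<Longrightarrow> redsJ (plug s m) (plug s m')"
  by (cases s) (auto intro: reds_Jmp reds_JWh)

lemma reds_body_plug: "reds m m' \<Longrightarrow> reds (body (plug s m)) (body (plug s m'))"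
  by (cases s) (auto intro: reds_Wh)

lemma is_val_rv [simp]: "is_val (rv Var e v)"
  by (cases v) auto

lemma JWh_Jmp: "eqJ (JWh j m) (Jmp (tail j) (Wh (body j) m))"
  by (meson E3 cJWh eqJ_Jmp_body reflT symJ transJ)

text \<open>The calculus substitutes values only in terms. For a jump, (E3) first moves the
  \<open>where\<close> below the label, where \<open>r_sub\<close> applies.\<close>

lemma redsJ_subst: assumes "is_val w" shows "redsJ (JWh j w) (substTj 0 w j)"
proof -
  have "redsJ (JWh j w) (Jmp (tail j) (Wh (body j) w))" by (rule eqJ_redsJ[OF JWh_Jmp])
  also have "redsJ \<dots> (Jmp (tail j) (substT 0 w (body j)))" by (intro reds_Jmp redT_reds r_sub assms)
  also have "redsJ \<dots> (substTj 0 w j)"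
    using eqJ_Jmp_body[of "substTj 0 w j"] by (auto intro: eqJ_redsJ symJ)
  finally show ?thesis .
qed

text \<open>A label is bound to the \<mu> by \<open>r_ren\<close> alone. For
  \<open>(J where x := \<box>)\<close> the jump is first brought to the form
  \<open>[k](M where x := \<box>)\<close>; \<open>r_mu\<close> then distributes \<open>M\<close>
  over the uses of the \<mu>-variable, and \<open>r_ren\<close> renames that variable to
  \<open>k\<close>.\<close>

lemma redsJ_plug_Mu:
  "redsJ (plug s (Mu (rj Var (SV 0 \<cdot> (\<lambda>k. liftKs 0 (e k))) q))) (rj Var (s \<cdot> e) q)" (is "redsJ (plug s (Mu ?J)) _")
proof -
  have ren: "renKj 0 l (rj Var (s \<cdot> (\<lambda>k. liftKs 0 (e k))) q) = rj Var (renKs 0 l s \<cdot> e) q" for l s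
    by (simp add: renK_rj comp_scons sk_commute)
  show ?thesis
  proof (cases s)
    case (SV l)
    have "redJ (Jmp l (Mu ?J)) (renKj 0 l ?J)" by (rule r_ren)
    then show ?thesis using SV by (auto simp: ren rnm_def intro: redJ_redsJ)
  next
    case (SL j)
    let ?b = "liftK 0 (body j)"
    have "redsJ (JWh j (Mu ?J)) (Jmp (tail j) (Wh (body j) (Mu ?J)))" by (rule eqJ_redsJ[OF JWh_Jmp])
    also have "redsJ \<dots> (Jmp (tail j) (Mu (sstj 0 ?b ?J)))" by (intro reds_Jmp redT_reds r_mu)
    also have "redsJ \<dots> (Jmp (tail j) (Mu (rj Var (SL (Jmp 0 ?b) \<cdot> (\<lambda>k. liftKs 0 (e k))) q)))"
      using sst_rj(2)[of 0 ?b "SV 0 \<cdot> (\<lambda>k. liftKs 0 (e k))" q]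
      by (intro eqJ_redsJ cJmp cMu) (simp add: comp_scons sk_commute)
    also have "redsJ \<dots> (renKj 0 (tail j) (rj Var (SL (Jmp 0 ?b) \<cdot> (\<lambda>k. liftKs 0 (e k))) q))"
      by (intro redJ_redsJ r_ren)
    also have "\<dots> = rj Var (SL (Jmp (tail j) (body j)) \<cdot> e) q"
      by (simp add: ren renK_liftK_cancel)
    also have "redsJ \<dots> (rj Var (SL j \<cdot> e) q)"
      by (intro eqJ_redsJ eqS_rj eqS_scons eqS_SL eqS_refl symJ[OF eqJ_Jmp_body])
    finally show ?thesis using SL by simp
  qed
qed

lemma rm_Var: "rm Var e q = (if linQ q then body (rj Var (SV 0 \<cdot> e) q)
     else Mu (rj Var (SV 0 \<cdot> (\<lambda>k. liftKs 0 (e k))) q))"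
  by (simp add: rm_def)

text \<open>The single point of the simulation at which \<open>r_muk\<close> is used: it removes the
  \<mu> of a command that is, or has just become, linear.\<close>

lemma reds_Mu_rm: "reds (Mu (rj Var (SV 0 \<cdot> (\<lambda>k. liftKs 0 (e k))) q)) (rm Var e q)"
proof (cases "linQ q")
  case True
  let ?j = "rj Var (SV 0 \<cdot> (\<lambda>k. liftKs 0 (e k))) q"
  have "eqJ ?j (Jmp 0 (liftK 0 (body (rj Var (SV 0 \<cdot> e) q))))"
    using eqJ_Jmp_body[of ?j] True by (simp add: lin_tail liftK_body)
  then have "reds (Mu ?j) (Mu (Jmp 0 (liftK 0 (body (rj Var (SV 0 \<cdot> e) q)))))"
    by (intro eqT_reds cMu)
  also have "reds \<dots> (body (rj Var (SV 0 \<cdot> e) q))" by (intro redT_reds r_muk)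
  finally show ?thesis using True by (simp add: rm_Var)
qed (simp add: rm_Var)

lemma redsJ_plug_rm: "redsJ (plug s (rm Var e q)) (rj Var (s \<cdot> e) q)"
  by (simp add: rm_Var redsJ_plug_Mu eqJ_redsJ lin_plug)

lemma rj_instK: "rj Var e (sbQ VV (k \<cdot> KV) q) = rj Var (rk Var e k \<cdot> e) q"
  by (simp add: rj_sb comp_scons)

lemma rj_scons2_cong: "\<not> ockQ (Suc 0) q \<Longrightarrow> rj x (a \<cdot> b \<cdot> e) q = rj x (a \<cdot> b' \<cdot> e) q"
proof (rule rj_cong)
  fix k assume "\<not> ockQ (Suc 0) q" "ockQ k q"
  then show "(a \<cdot> b \<cdot> e) k = (a \<cdot> b' \<cdot> e) k"
    by (cases k) (auto simp: scons_def split: nat.splits)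
qed

text \<open>The counterpart of \<open>redsJ_plug_rm\<close> when the return point of the caller,
  index 1 of \<open>q\<close>, has no \<mu> of its own. If \<open>q\<close> is nonlinear, its \<mu>
  takes over this role: \<open>r_mu\<close> moves it outside the \<open>where\<close>s read from
  \<open>k\<close>, and the two return points merge.\<close>

lemma reds_body_plug_rm:
  assumes k: "linK k" and q: "\<not> ockQ (Suc 0) q"
  shows "reds (body (plug (rk Var (SV 0 \<cdot> e) k) (rm Var (SV 0 \<cdot> e) q))) (rm Var e (sbQ VV (k \<cdot> KV) q))"
proof (cases "linQ q")
  case True
  have "linQ (sbQ VV (k \<cdot> KV) q)"
    using True k q by (intro lin_sb_imp(1)) (auto intro!: gr0I)
  moreover have "eqT (body (plug s (body (rj Var (SV 0 \<cdot> SV 0 \<cdot> e) q)))) (body (rj Var (s \<cdot> SV 0 \<cdot> e) q))" for s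
    using eqJ_body[OF lin_plug(1)[OF True]] by blast
  ultimately show ?thesis using True by (simp add: rm_Var rj_instK eqT_reds)
next
  case False
  let ?E = "SV 0 \<cdot> (\<lambda>k. liftKs 0 (e k))"
  let ?J = "rj Var (SV 0 \<cdot> ?E) q"
  have env: "(SV 0 \<cdot> (\<lambda>k. liftKs 0 ((SV 0 \<cdot> e) k))) = SV 0 \<cdot> SV 1 \<cdot> (\<lambda>k. liftKs 0 (e k))"
    by (simp add: comp_scons)
  \<comment> \<open>Under the \<mu> of \<open>q\<close> the dummy for the caller's return point has
    been lifted to \<open>SV 1\<close>. As index 1 does not occur in \<open>q\<close> it may be
    reset to \<open>SV 0\<close>, so that both return points share one \<mu>.\<close>
  have rm: "rm Var (SV 0 \<cdot> e) q = Mu ?J"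
    using False rj_scons2_cong[OF q, of Var "SV 0" "SV 1"] by (simp add: rm_Var env)
  have "reds (body (plug (rk Var (SV 0 \<cdot> e) k) (Mu ?J))) (Mu (rj Var (rk Var ?E k \<cdot> ?E) q))"
  proof (cases k)
    case (KV i)
    then show ?thesis using k by simp
  next
    case (KL q2)
    let ?f = "\<lambda>k. liftTs 0 (e k)"
    let ?j = "rj Var (SV 0 \<cdot> ?f) q2"
    let ?j' = "rj Var (SV 0 \<cdot> (\<lambda>k. liftKs 0 (?f k))) q2"
    let ?b = "liftK 0 (body ?j)"
    have lin: "linQ q2" using k KL by simp
    have rk: "rk Var (SV 0 \<cdot> e) k = SL ?j" "rk Var ?E k = SL ?j'"
      using KL by (simp_all add: upT_env comp_scons sk_commute)
    have j': "eqJ ?j' (Jmp 0 ?b)"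
      using eqJ_Jmp_body[of ?j'] lin by (simp add: lin_tail liftK_body)
    have "reds (Wh (body ?j) (Mu ?J)) (Mu (sstj 0 ?b ?J))" by (intro redT_reds r_mu)
    also have "reds \<dots> (Mu (rj Var (\<lambda>k. ssts 0 ?b ((SV 0 \<cdot> ?E) k)) q))"
      by (intro eqT_reds cMu sst_rj)
    also have "\<dots> = Mu (rj Var (SL (Jmp 0 ?b) \<cdot> ?E) q)"
      using rj_scons2_cong[OF q, of Var "SL (Jmp 0 ?b)" "SL (Jmp 0 ?b)" _ "SV 0"]
      by (simp add: comp_scons sk_commute)
    also have "reds \<dots> (Mu (rj Var (SL ?j' \<cdot> ?E) q))"
      by (intro eqT_reds cMu eqS_rj eqS_scons eqS_SL eqS_refl symJ[OF j'])
    finally show ?thesis by (simp add: rk)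
  qed
  also have "reds \<dots> (rm Var e (sbQ VV (k \<cdot> KV) q))"
    using reds_Mu_rm[of e "sbQ VV (k \<cdot> KV) q"] by (simp add: rj_instK)
  finally show ?thesis by (simp add: rm)
qed

lemma substs_cancel: "substs 0 w (liftTs 0 s) = s"
  by (cases s) (simp_all add: substT_liftT_cancel)

lemma substT0_Var: "(\<lambda>i. substT 0 w (Var i)) = w \<cdot> Var"
  by (rule ext, case_tac i; simp)

lemma substTj_rj: "substTj 0 w (rj Var (\<lambda>k. liftTs 0 (e k)) q) = rj (w \<cdot> Var) e q"
  by (simp only: substT_rj substT0_Var substs_cancel)

lemma rj_inst1: "rj Var e (inst1 W q) = substTj 0 (rv Var e W) (rj Var (\<lambda>k. liftTs 0 (e k)) q)"
  by (simp add: substTj_rj rj_sb comp_scons)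

text \<open>Extends \<open>rm\<close> from commands to a continuation applied to an arbitrary term
  \<open>m\<close>. The simulation for continuations needs this generality: \<open>m\<close> may be
  a value, an application, or the readback of a contracted call.\<close>

definition rmk :: "(nat \<Rightarrow> sk) \<Rightarrow> kon \<Rightarrow> trm \<Rightarrow> trm" where
  "rmk e k m = (if linK k then body (plug (rk Var (SV 0 \<cdot> e) k) m)
     else Mu (plug (rk Var (SV 0 \<cdot> (\<lambda>k. liftKs 0 (e k))) k) (liftK 0 m)))"

lemma liftK_rv:
  "\<not> ockV 0 w \<Longrightarrow> liftK 0 (rv Var (SV 0 \<cdot> e) w) = rv Var (SV 0 \<cdot> (\<lambda>k. liftKs 0 (e k))) w"
  by (simp add: liftK_rj comp_scons rv_scons_cong[where a="SV (Suc 0)" and b="SV 0"])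

lemma rmk_Ret: "\<not> ockV 0 w \<Longrightarrow> rmk e k (rv Var (SV 0 \<cdot> e) w) = rm Var e (Ret k w)"
  by (simp add: rmk_def rm_Var liftK_rv)

lemma rmk_Cal: "\<not> ockV 0 v \<Longrightarrow> \<not> ockV 0 w \<Longrightarrow>
   rmk e k (App (rv Var (SV 0 \<cdot> e) v) (rv Var (SV 0 \<cdot> e) w)) = rm Var e (Cal v w k)"
  by (simp add: rmk_def rm_Var liftK_rv)

lemma liftK_rm: "\<not> ockQ (Suc 0) q \<Longrightarrow>
  liftK 0 (rm Var (SV 0 \<cdot> e) q) = rm Var (SV 0 \<cdot> (\<lambda>k. liftKs 0 (e k))) q"
proof -
  assume q: "\<not> ockQ (Suc 0) q"
  have c: "rj Var (a \<cdot> SV (Suc i) \<cdot> f) q = rj Var (a \<cdot> SV 0 \<cdot> f) q" for a i f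
    by (rule rj_scons2_cong[OF q])
  show ?thesis
    by (simp add: rm_Var comp_scons c sk_commute liftK_rj(2) flip: liftK_body)
qed

definition wkV :: "val \<Rightarrow> val" where "wkV = rnV (\<lambda>i. i) Suc"

text \<open>The source performs a call in two stages, substituting the argument and then plugging
  the result into the continuation. Between them continuation 0 is still open, so the argument is
  weakened by \<open>wkV\<close>.\<close>

lemma inst2_split: "inst2 W K q = sbQ VV (K \<cdot> KV) (sbQ (wkV W \<cdot> VV) KV q)"
  by (simp add: sb_sb comp_scons wkV_def sb_rn)

lemma rv_wkV: "rv x (s \<cdot> e) (wkV W) = rv x e W"
  by (simp add: wkV_def rj_rn)

lemma rm_substT:
  "substT 0 (rv Var e W) (rm Var (\<lambda>k. liftTs 0 (e k)) q) = rm Var e (sbQ (wkV W \<cdot> VV) KV q)"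
proof -
  have lin: "linQ (sbQ (wkV W \<cdot> VV) KV q) = linQ q"
    by (rule lin_sb, case_tac i) (auto simp: wkV_def ock_rn)
  have 1: "(SV 0 \<cdot> (\<lambda>k. liftTs 0 (f k))) = (\<lambda>k. liftTs 0 ((SV 0 \<cdot> f) k))" for f
    by (simp add: comp_scons)
  have "substTj 0 w (rj Var (SV 0 \<cdot> (\<lambda>k. liftTs 0 (f k))) q) = rj (w \<cdot> Var) (SV 0 \<cdot> f) q" for w f
    by (simp only: 1 substTj_rj)
  moreover have "rj Var f (sbQ (wkV W \<cdot> VV) KV q) = rj (rv Var f (wkV W) \<cdot> Var) f q" for f
    by (simp add: rj_sb comp_scons)
  moreover have "liftK 0 (rv Var e W) = rv Var (\<lambda>k. liftKs 0 (e k)) W" by (simp add: liftK_rj)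
  ultimately show ?thesis
    by (simp add: rm_Var lin rv_wkV sk_commute flip: body_ops(5))
qed

lemma not_ock_wk: "\<not> ockV 0 (VL q) \<Longrightarrow> \<not> ockV 0 W \<Longrightarrow> \<not> ockQ (Suc 0) (sbQ (wkV W \<cdot> VV) KV q)"
  by (rule notI, drule ock_sb(2)) (auto simp: wkV_def ock_rn ex_scons)

lemma reds_beta:
  assumes "reds (rm Var (\<lambda>k. liftTs 0 (e k)) q) (rm Var (\<lambda>k. liftTs 0 (e k)) q')"
    and "reds (rv Var e W) (rv Var e W')"
  shows "reds (App (rv Var e (VL q)) (rv Var e W)) (rm Var e (sbQ (wkV W' \<cdot> VV) KV q'))"
proof -
  have "reds (App (rv Var e (VL q)) (rv Var e W)) (App (Lam (rm Var (\<lambda>k. liftTs 0 (e k)) q')) (rv Var e W'))"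
    using assms by (simp only: rv_VL upT_env) (intro reds_App reds_Lam)
  also have "reds \<dots> (Wh (rm Var (\<lambda>k. liftTs 0 (e k)) q') (rv Var e W'))" by (intro redT_reds r_beta) simp
  also have "reds \<dots> (substT 0 (rv Var e W') (rm Var (\<lambda>k. liftTs 0 (e k)) q'))" by (intro redT_reds r_sub) simp
  finally show ?thesis by (simp only: rm_substT)
qed

lemma reds_rm:
  assumes "redsJ (rj Var (SV 0 \<cdot> (\<lambda>k. liftKs 0 (e k))) q) (rj Var (SV 0 \<cdot> (\<lambda>k. liftKs 0 (e k))) q')"
    and "linQ q \<longrightarrow> reds (body (rj Var (SV 0 \<cdot> e) q)) (rm Var e q')"
  shows "reds (rm Var e q) (rm Var e q')"
proof (cases "linQ q")
  case False
  then have "reds (rm Var e q) (Mu (rj Var (SV 0 \<cdot> (\<lambda>k. liftKs 0 (e k))) q'))"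
    using reds_Mu[OF assms(1)] by (simp add: rm_Var)
  also have "reds \<dots> (rm Var e q')" by (rule reds_Mu_rm)
  finally show ?thesis .
qed (use assms in \<open>simp add: rm_Var\<close>)

lemma eta_plug: "redsJ (JWh (plug (liftTs 0 s) (Var 0)) m) (plug s m)"
proof -
  have "redsJ (JWh (plug (liftTs 0 s) (Var 0)) m) (plug s (Wh (Var 0) m))"
    by (rule eqJ_redsJ[OF symJ[OF plug_Wh]])
  also have "redsJ \<dots> (plug s m)" by (intro reds_plug redT_reds r_var)
  finally show ?thesis .
qed

lemma eta_body_plug: "reds (Wh (body (plug (liftTs 0 s) (Var 0))) m) (body (plug s m))"
proof -
  have "reds (Wh (body (plug (liftTs 0 s) (Var 0))) m) (body (plug s (Wh (Var 0) m)))"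
    using eqJ_body[OF symJ[OF plug_Wh[of s "Var 0" m]]] by (simp add: eqT_reds)
  also have "reds \<dots> (body (plug s m))" by (intro reds_body_plug redT_reds r_var)
  finally show ?thesis .
qed

lemma rk_eta: "rk Var e (KL (Ret (shK K) (VV 0))) = SL (plug (liftTs 0 (rk Var e K)) (Var 0))"
  by (simp add: upT_env rj_rn liftT_rj) 

text \<open>A linear command may become nonlinear when a called function uses its continuation nonlinearly;
therefore the second conjunct ends in \<open>rm\<close> rather than in \<open>body\<close>.\<close>

lemma simulation:
  "pV v v' \<Longrightarrow> \<forall>e. reds (rv Var e v) (rv Var e v')"
  "pQ q q' \<Longrightarrow> \<forall>e. redsJ (rj Var e q) (rj Var e q') \<and>
     (linQ q \<longrightarrow> reds (body (rj Var (SV 0 \<cdot> e) q)) (rm Var e q'))"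
  "pK k k' \<Longrightarrow> \<forall>e m. redsJ (plug (rk Var e k) m) (plug (rk Var e k') m) \<and>
     (linK k \<longrightarrow> reds (body (plug (rk Var (SV 0 \<cdot> e) k) m)) (rmk e k' m))"
proof (induct rule: pV_pQ_pK.inducts)
  case (pVL Q Q')
  then show ?case by (simp only: rv_VL upT_env) (intro allI reds_Lam reds_rm; simp)
next
  case (pVeta W W')
  show ?case
  proof
    fix e
    \<comment> \<open>The continuation \<open>KV 0\<close> makes the command linear, so the readback
      contains no \<mu> and is literally a source eta redex.\<close>
    have "rv Var e (VL (Cal (sh2V W) (VV 0) (KV 0))) = Lam (App (liftT 0 (rv Var e W)) (Var 0))"
      by (simp add: ock_rn upT_env rj_rn liftT_rj)
    then have "reds (rv Var e (VL (Cal (sh2V W) (VV 0) (KV 0)))) (rv Var e W)"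
      by (simp only:) (intro redT_reds r_eta is_val_rv)
    also have "reds \<dots> (rv Var e W')" using pVeta by blast
    finally show "reds (rv Var e (VL (Cal (sh2V W) (VV 0) (KV 0)))) (rv Var e W')" .
  qed
next
  case (pRet K K' W W')
  show ?case
  proof (intro allI conjI impI)
    fix e
    have "redsJ (plug (rk Var e K) (rv Var e W)) (plug (rk Var e K) (rv Var e W'))"
      using pRet by (intro reds_plug) blast
    also have "redsJ \<dots> (plug (rk Var e K') (rv Var e W'))" using pRet by blast
    finally show "redsJ (rj Var e (Ret K W)) (rj Var e (Ret K' W'))" by simp
    assume lin: "linQ (Ret K W)"
    have W': "\<not> ockV 0 W'" using lin p_oc(1)[OF \<open>pV W W'\<close>] by auto
    have "reds (body (plug (rk Var (SV 0 \<cdot> e) K) (rv Var (SV 0 \<cdot> e) W))) (body (plug (rk Var (SV 0 \<cdot> e) K) (rv Var (SV 0 \<cdot> e) W')))"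
      using pRet by (intro reds_body_plug) blast
    also have "reds \<dots> (rmk e K' (rv Var (SV 0 \<cdot> e) W'))" using pRet lin by simp
    finally show "reds (body (rj Var (SV 0 \<cdot> e) (Ret K W))) (rm Var e (Ret K' W'))"
      by (simp add: rmk_Ret W')
  qed
next
  case (pRetb Q Q' W W')
  show ?case
  proof (intro allI conjI impI)
    fix e
    have "redsJ (JWh (rj Var (\<lambda>k. liftTs 0 (e k)) Q) (rv Var e W)) (JWh (rj Var (\<lambda>k. liftTs 0 (e k)) Q') (rv Var e W'))"
      using pRetb by (intro reds_JWh) blast+
    also have "redsJ \<dots> (rj Var e (inst1 W' Q'))" unfolding rj_inst1 by (rule redsJ_subst) simp
    finally show "redsJ (rj Var e (Ret (KL Q) W)) (rj Var e (inst1 W' Q'))" by (simp add: upT_env)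
    assume lin: "linQ (Ret (KL Q) W)"
    have W': "\<not> ockV 0 W'" using lin p_oc(1)[OF \<open>pV W W'\<close>] by auto
    let ?f = "\<lambda>k. liftTs 0 (e k)"
    let ?w = "rv Var (SV 0 \<cdot> e) W'"
    have sub: "rj Var (SV 0 \<cdot> g) (inst1 W' Q') = substTj 0 (rv Var (SV 0 \<cdot> g) W') (rj Var (SV 0 \<cdot> (\<lambda>k. liftTs 0 (g k))) Q')" for g
      by (simp add: rj_inst1 comp_scons)
    have "reds (Wh (body (rj Var (SV 0 \<cdot> ?f) Q)) (rv Var (SV 0 \<cdot> e) W)) (Wh (rm Var ?f Q') ?w)"
      using pRetb lin by (intro reds_Wh) simp_all
    also have "reds \<dots> (rm Var e (inst1 W' Q'))"
    proof (cases "linQ Q'")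
      case True
      have "linQ (inst1 W' Q')"
        using True by (intro lin_sb_imp(1), assumption, case_tac i) (auto simp: W')
      moreover have "reds (Wh (rm Var ?f Q') ?w) (substT 0 ?w (rm Var ?f Q'))" by (intro redT_reds r_sub) simp
      ultimately show ?thesis using True by (simp add: rm_Var sub)
    next
      case False
      let ?E = "\<lambda>k. liftKs 0 (e k)"
      \<comment> \<open>\<open>Q'\<close> is nonlinear and its readback starts with a \<mu>; (E2)
        moves the \<open>where\<close> below it, to the level of jumps.\<close>
      have "reds (Wh (rm Var ?f Q') ?w) (Mu (JWh (rj Var (SV 0 \<cdot> (\<lambda>k. liftTs 0 (?E k))) Q') (liftK 0 ?w)))"
        using False by (simp add: rm_Var sk_commute eqT_reds E2)
      also have "reds \<dots> (Mu (substTj 0 (liftK 0 ?w) (rj Var (SV 0 \<cdot> (\<lambda>k. liftTs 0 (?E k))) Q')))"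
        by (intro reds_Mu redsJ_subst) simp
      also have "\<dots> = Mu (rj Var (SV 0 \<cdot> ?E) (inst1 W' Q'))"
        by (simp add: sub liftK_rv W')
      also have "reds \<dots> (rm Var e (inst1 W' Q'))" by (rule reds_Mu_rm)
      finally show ?thesis .
    qed
    finally show "reds (body (rj Var (SV 0 \<cdot> e) (Ret (KL Q) W))) (rm Var e (inst1 W' Q'))"
      by (simp add: upT_env comp_scons)
  qed
next
  case (pCal V V' W W' K K')
  show ?case
  proof (intro allI conjI impI)
    fix e
    have "redsJ (plug (rk Var e K) (App (rv Var e V) (rv Var e W))) (plug (rk Var e K) (App (rv Var e V') (rv Var e W')))"
      using pCal by (intro reds_plug reds_App) blast+
    also have "redsJ \<dots> (plug (rk Var e K') (App (rv Var e V') (rv Var e W')))" using pCal by blast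
    finally show "redsJ (rj Var e (Cal V W K)) (rj Var e (Cal V' W' K'))" by simp
    assume lin: "linQ (Cal V W K)"
    have W': "\<not> ockV 0 W'" "\<not> ockV 0 V'" using lin p_oc(1)[OF \<open>pV W W'\<close>] p_oc(1)[OF \<open>pV V V'\<close>] by auto
    have "reds (body (plug (rk Var (SV 0 \<cdot> e) K) (App (rv Var (SV 0 \<cdot> e) V) (rv Var (SV 0 \<cdot> e) W))))
       (body (plug (rk Var (SV 0 \<cdot> e) K) (App (rv Var (SV 0 \<cdot> e) V') (rv Var (SV 0 \<cdot> e) W'))))"
      using pCal by (intro reds_body_plug reds_App) blast+
    also have "reds \<dots> (rmk e K' (App (rv Var (SV 0 \<cdot> e) V') (rv Var (SV 0 \<cdot> e) W')))" using pCal lin by simp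
    finally show "reds (body (rj Var (SV 0 \<cdot> e) (Cal V W K))) (rm Var e (Cal V' W' K'))"
      by (simp add: rmk_Cal W')
  qed
next
  case (pCalb Q Q' W W' K K')
  let ?q = "sbQ (wkV W' \<cdot> VV) KV Q'"
  have app: "reds (App (rv Var e (VL Q)) (rv Var e W)) (rm Var e ?q)" for e
    using pCalb by (intro reds_beta reds_rm) simp_all
  show ?case
  proof (intro allI conjI impI)
    fix e
    have "redsJ (plug (rk Var e K) (App (rv Var e (VL Q)) (rv Var e W))) (plug (rk Var e K) (rm Var e ?q))"
      by (intro reds_plug app)
    also have "redsJ \<dots> (plug (rk Var e K') (rm Var e ?q))" using pCalb by blast
    also have "redsJ \<dots> (rj Var e (inst2 W' K' Q'))"
      unfolding inst2_split rj_instK by (rule redsJ_plug_rm)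
    finally show "redsJ (rj Var e (Cal (VL Q) W K)) (rj Var e (inst2 W' K' Q'))" by simp
    assume lin: "linQ (Cal (VL Q) W K)"
    have "\<not> ockV 0 W'" "\<not> ockV 0 (VL Q')"
      using lin p_oc(1)[OF \<open>pV W W'\<close>] p_oc(2)[OF \<open>pQ Q Q'\<close>] by auto
    then have q: "\<not> ockQ (Suc 0) ?q" by (intro not_ock_wk)
    let ?E = "\<lambda>k. liftKs 0 (e k)"
    have "reds (body (plug (rk Var (SV 0 \<cdot> e) K) (App (rv Var (SV 0 \<cdot> e) (VL Q)) (rv Var (SV 0 \<cdot> e) W))))
       (body (plug (rk Var (SV 0 \<cdot> e) K) (rm Var (SV 0 \<cdot> e) ?q)))"
      by (intro reds_body_plug app)
    also have "reds \<dots> (rmk e K' (rm Var (SV 0 \<cdot> e) ?q))" using pCalb lin by simp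
    also have "reds \<dots> (rm Var e (inst2 W' K' Q'))"
    proof (cases "linK K'")
      case True
      then show ?thesis using reds_body_plug_rm[OF True q] by (simp add: rmk_def inst2_split)
    next
      case False
      have "reds (Mu (plug (rk Var (SV 0 \<cdot> ?E) K') (rm Var (SV 0 \<cdot> ?E) ?q))) (Mu (rj Var (SV 0 \<cdot> ?E) (inst2 W' K' Q')))"
        unfolding inst2_split rj_instK by (intro reds_Mu redsJ_plug_rm)
      also have "reds \<dots> (rm Var e (inst2 W' K' Q'))" by (rule reds_Mu_rm)
      finally show ?thesis using False by (simp add: rmk_def liftK_rm q)
    qed
    finally show "reds (body (rj Var (SV 0 \<cdot> e) (Cal (VL Q) W K))) (rm Var e (inst2 W' K' Q'))"
      by simp
  qed
next
  case (pKV k)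
  then show ?case by (simp add: rmk_def)
next
  case (pKL Q Q')
  show ?case
  proof (intro allI conjI impI)
    fix e m
    show "redsJ (plug (rk Var e (KL Q)) m) (plug (rk Var e (KL Q')) m)"
      using pKL by (simp add: upT_env reds_JWh)
    assume lin: "linK (KL Q)"
    let ?f = "\<lambda>k. liftTs 0 (e k)"
    have "reds (Wh (body (rj Var (SV 0 \<cdot> ?f) Q)) m) (Wh (rm Var ?f Q') m)"
      using pKL lin by (intro reds_Wh) simp_all
    \<comment> \<open>If \<open>Q'\<close> is nonlinear, (E2) exchanges its \<mu> with the
      surrounding \<open>where\<close>; otherwise both sides agree.\<close>
    also have "reds \<dots> (rmk e (KL Q') m)"
      by (simp add: rm_Var rmk_def upT_env comp_scons sk_commute eqT_reds E2)
    finally show "reds (body (plug (rk Var (SV 0 \<cdot> e) (KL Q)) m)) (rmk e (KL Q') m)"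
      by (simp add: upT_env comp_scons)
  qed
next
  case (pKeta K K')
  show ?case
  proof (intro allI conjI impI)
    fix e m
    have "redsJ (plug (rk Var e (KL (Ret (shK K) (VV 0)))) m) (plug (rk Var e K) m)"
      using eta_plug by (simp only: rk_eta plug.simps)
    also have "redsJ \<dots> (plug (rk Var e K') m)" using pKeta by blast
    finally show "redsJ (plug (rk Var e (KL (Ret (shK K) (VV 0)))) m) (plug (rk Var e K') m)" .
    assume "linK (KL (Ret (shK K) (VV 0)))"
    then have lin: "linK K" by (simp add: lin_rn)
    have "reds (body (plug (rk Var (SV 0 \<cdot> e) (KL (Ret (shK K) (VV 0)))) m)) (body (plug (rk Var (SV 0 \<cdot> e) K) m))"
      using eta_body_plug by (simp only: rk_eta plug.simps body.simps)
    also have "reds \<dots> (rmk e K' m)" using pKeta lin by blast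
    finally show "reds (body (plug (rk Var (SV 0 \<cdot> e) (KL (Ret (shK K) (VV 0)))) m)) (rmk e K' m)" .
  qed
qed simp_all

lemma reds_rm_pQ: "pQ\<^sup>*\<^sup>* q q' \<Longrightarrow> reds (rm Var e q) (rm Var e q')"
proof (induct rule: rtranclp_induct)
  case (step y z)
  have "reds (rm Var e y) (rm Var e z)" using simulation(2)[OF step(2)] by (intro reds_rm) auto
  with step(3) show ?case by (rule reds_trans)
qed simp

section \<open>The theorem\<close>

text \<open>The middle clause with \<open>KV 0\<close> for \<open>K\<close> is what the theorem
  uses: free continuation variables are shifted so that index 0 is the return point. The first
  clause covers subterms below a \<mu>, the last one values in operator or operand position.\<close>

definition adequate :: "trm \<Rightarrow> bool" where
  "adequate m \<longleftrightarrow>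
    (\<forall>K. redsJ (plug (rk Var SV K) m) (rj Var SV (tr VV KV m K))) \<and>
    (\<forall>K. linK K \<longrightarrow> reds (body (plug (rk Var (SV 0 \<cdot> SV) K) m)) (rm Var SV (tr VV (\<lambda>k. KV (Suc k)) m K))) \<and>
    (is_val m \<longrightarrow> reds m (rv Var SV (trv VV KV m)))"

lemma adequateD:
  assumes "adequate m"
  shows "redsJ (plug (rk Var SV K) m) (rj Var SV (tr VV KV m K))"
    "linK K \<Longrightarrow> reds (body (plug (rk Var (SV 0 \<cdot> SV) K) m)) (rm Var SV (tr VV (\<lambda>k. KV (Suc k)) m K))"
    "is_val m \<Longrightarrow> reds m (rv Var SV (trv VV KV m))"
  using assms by (auto simp: adequate_def)

lemma SV_scons: "SV 0 \<cdot> (\<lambda>k. SV (Suc k)) = SV"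
  by (rule scons_eqI) simp_all

lemma trv_Suc: "is_val m \<Longrightarrow> trv VV (\<lambda>k. KV (Suc k)) m = wkV (trv VV KV m)"
  by (simp add: wkV_def rn_trv)

lemma ock_wkV: "\<not> ockV 0 (wkV v)"
  by (simp add: wkV_def ock_rn)

lemma adequate_val:
  assumes "is_val m" "reds m (rv Var SV (trv VV KV m))"
  shows "adequate m"
  unfolding adequate_def using assms
  by (auto simp: tr_val trv_Suc rm_Var rv_wkV ock_wkV intro: reds_plug reds_body_plug)

lemma adequate_App_val:
  assumes "is_val m" "is_val n" "adequate m" "adequate n"
  shows "adequate (App m n)"
proof -
  have "reds (App m n) (App (rv Var SV (trv VV KV m)) (rv Var SV (trv VV KV n)))"
    using assms by (intro reds_App adequateD)
  then show ?thesis
    unfolding adequate_def using assms(1,2)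
    by (auto simp: trv_Suc rm_Var rv_wkV ock_wkV intro: reds_plug reds_body_plug)
qed

lemma rk_shK: "rk Var e (shK K) = liftTs 0 (rk Var e K)" if "\<And>k. liftTs 0 (e k) = e k"
  using that by (simp add: rj_rn liftT_rj)

text \<open>The assumption on \<open>liftK 0 m\<close> arises because (E2) carries \<open>m\<close>
  under the \<mu> of a nonlinear \<open>l\<close>. Lifted terms are not subterms, so
  \<open>adequate_all\<close> inducts on the size, which lifting preserves.\<close>

lemma adequate_Wh:
  assumes l: "adequate l" and m: "adequate m" and m': "adequate (liftK 0 m)"
  shows "adequate (Wh l m)"
proof -
  have "redsJ (plug (rk Var SV K) (Wh l m)) (rj Var SV (tr VV KV (Wh l m) K))" for K
  proof -
    have "redsJ (plug (rk Var SV K) (Wh l m)) (JWh (plug (rk Var SV (shK K)) l) m)"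
      using eqJ_redsJ[OF plug_Wh, of "rk Var SV K" l m] by (simp add: rk_shK)
    also have "redsJ \<dots> (JWh (rj Var SV (tr VV KV l (shK K))) m)"
      by (intro reds_JWh adequateD l reds_refl)
    also have "\<dots> = plug (rk Var SV (KL (tr VV KV l (shK K)))) m" by (simp add: upT_env)
    also have "redsJ \<dots> (rj Var SV (tr VV KV m (KL (tr VV KV l (shK K)))))" by (rule adequateD[OF m])
    finally show ?thesis by simp
  qed
  moreover have "reds (body (plug (rk Var (SV 0 \<cdot> SV) K) (Wh l m))) (rm Var SV (tr VV (\<lambda>k. KV (Suc k)) (Wh l m) K))"
    if K: "linK K" for K
  proof -
    let ?q = "tr VV (\<lambda>k. KV (Suc k)) l (shK K)"
    have "liftTs 0 ((SV 0 \<cdot> SV) k) = (SV 0 \<cdot> SV) k" for k by (cases k) auto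
    then have "reds (body (plug (rk Var (SV 0 \<cdot> SV) K) (Wh l m))) (Wh (body (plug (rk Var (SV 0 \<cdot> SV) (shK K)) l)) m)"
      using eqJ_body[OF plug_Wh[of "rk Var (SV 0 \<cdot> SV) K" l m]] by (simp add: rk_shK eqT_reds)
    also have "reds \<dots> (Wh (rm Var SV ?q) m)"
      using K by (intro reds_Wh adequateD l reds_refl) (simp add: lin_rn)
    also have "reds \<dots> (rm Var SV (tr VV (\<lambda>k. KV (Suc k)) m (KL ?q)))"
    proof (cases "linQ ?q")
      case True
      then show ?thesis using adequateD(2)[OF m, of "KL ?q"] by (simp add: rm_Var upT_env comp_scons)
    next
      case False
      have "reds (Wh (rm Var SV ?q) m) (Mu (plug (rk Var SV (KL ?q)) (liftK 0 m)))"
        using False by (simp add: rm_Var SV_scons upT_env eqT_reds E2)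
      also have "reds \<dots> (Mu (rj Var SV (tr VV KV (liftK 0 m) (KL ?q))))"
        by (intro reds_Mu adequateD m')
      also have "\<dots> = Mu (rj Var (SV 0 \<cdot> (\<lambda>k. liftKs 0 (SV k))) (tr VV (\<lambda>k. KV (Suc k)) m (KL ?q)))"
        by (simp add: SV_scons tr_lift)
      also have "reds \<dots> (rm Var SV (tr VV (\<lambda>k. KV (Suc k)) m (KL ?q)))" by (rule reds_Mu_rm)
      finally show ?thesis .
    qed
    finally show ?thesis by simp
  qed
  ultimately show ?thesis by (simp add: adequate_def)
qed

lemma adequate_expand:
  assumes "adequate n" "reds m n" "\<not> is_val m" "\<And>s t K. tr s t m K = tr s t n K"
  shows "adequate m"
  unfolding adequate_def
proof (intro conjI allI impI)
  fix K
  show "redsJ (plug (rk Var SV K) m) (rj Var SV (tr VV KV m K))"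
    using redsJ_trans[OF reds_plug[OF assms(2)] adequateD(1)[OF assms(1)]] by (simp add: assms(4))
  assume "linK K"
  then show "reds (body (plug (rk Var (SV 0 \<cdot> SV) K) m)) (rm Var SV (tr VV (\<lambda>k. KV (Suc k)) m K))"
    using reds_trans[OF reds_body_plug[OF assms(2)] adequateD(2)[OF assms(1)]] by (simp add: assms(4))
qed (use assms in simp)

lemma adequate_App_nv2:
  assumes "is_val m" "\<not> is_val n" "adequate (liftT 0 m)" "adequate n" "adequate (liftK 0 n)"
  shows "adequate (App m n)"
proof (rule adequate_expand)
  have "adequate (Var 0)" by (rule adequate_val) simp_all
  then show "adequate (Wh (App (liftT 0 m) (Var 0)) n)"
    using assms by (intro adequate_Wh adequate_App_val) simp_all
  show "reds (App m n) (Wh (App (liftT 0 m) (Var 0)) n)" using assms by (intro redT_reds r_nv2)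
  show "tr s t (App m n) K = tr s t (Wh (App (liftT 0 m) (Var 0)) n) K" for s t K
    using assms by (intro tr_nv2)
qed simp

lemma adequate_App_nv1:
  assumes "\<not> is_val m" "adequate (App (Var 0) (liftT 0 n))" "adequate m" "adequate (liftK 0 m)"
  shows "adequate (App m n)"
proof (rule adequate_expand)
  show "adequate (Wh (App (Var 0) (liftT 0 n)) m)" using assms by (intro adequate_Wh)
  show "reds (App m n) (Wh (App (Var 0) (liftT 0 n)) m)" using assms by (intro redT_reds r_nv1)
  show "tr s t (App m n) K = tr s t (Wh (App (Var 0) (liftT 0 n)) m) K" for s t K
    using assms by (intro tr_nv1)
qed simp

lemma adequate_Mu:
  assumes j: "redsJ j (rj Var SV (trj VV KV j))"
  shows "adequate (Mu j)"
  unfolding adequate_def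
proof (intro conjI allI impI)
  fix K
  let ?q = "trj VV KV j"
  have "reds (Mu j) (Mu (rj Var SV ?q))" by (rule reds_Mu[OF j])
  also have "reds \<dots> (rm Var SV ?q)" using reds_Mu_rm[of SV ?q] by (simp add: SV_scons)
  finally have "redsJ (plug (rk Var SV K) (Mu j)) (plug (rk Var SV K) (rm Var SV ?q))" by (rule reds_plug)
  also have "redsJ \<dots> (rj Var SV (sbQ VV (K \<cdot> KV) ?q))" unfolding rj_instK by (rule redsJ_plug_rm)
  finally show "redsJ (plug (rk Var SV K) (Mu j)) (rj Var SV (tr VV KV (Mu j) K))" by (simp add: sb_tr)
  assume K: "linK K"
  let ?c = "0 \<cdot> (\<lambda>k. Suc (Suc k))"
  let ?p = "rnQ (\<lambda>i. i) ?c ?q"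
  have "(\<lambda>k. (SV 0 \<cdot> (\<lambda>k. liftKs 0 ((SV 0 \<cdot> SV) k))) (?c k)) = SV"
    by (rule ext, case_tac k) simp_all
  then have "rj Var SV ?q = rj Var (SV 0 \<cdot> (\<lambda>k. liftKs 0 ((SV 0 \<cdot> SV) k))) ?p" by (simp add: rj_rn)
  then have "reds (Mu j) (Mu (rj Var (SV 0 \<cdot> (\<lambda>k. liftKs 0 ((SV 0 \<cdot> SV) k))) ?p))"
    using reds_Mu[OF j] by simp
  also have "reds \<dots> (rm Var (SV 0 \<cdot> SV) ?p)" by (rule reds_Mu_rm)
  finally have "reds (body (plug (rk Var (SV 0 \<cdot> SV) K) (Mu j))) (body (plug (rk Var (SV 0 \<cdot> SV) K) (rm Var (SV 0 \<cdot> SV) ?p)))"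
    by (rule reds_body_plug)
  also have "reds \<dots> (rm Var SV (sbQ VV (K \<cdot> KV) ?p))"
    by (rule reds_body_plug_rm[OF K]) (auto simp: ock_rn scons_def split: nat.splits)
  also have "sbQ VV (K \<cdot> KV) ?p = tr VV (\<lambda>k. KV (Suc k)) (Mu j) K"
    by (simp add: sb_rn sb_tr comp_scons)
  finally show "reds (body (plug (rk Var (SV 0 \<cdot> SV) K) (Mu j))) (rm Var SV (tr VV (\<lambda>k. KV (Suc k)) (Mu j) K))" .
qed simp

lemma size_liftT [simp]: "size (liftT c m) = size m" "size (liftTj c j) = size j"
  by (induct m and j arbitrary: c and c) simp_all

lemma size_liftK [simp]: "size (liftK c m) = size m" "size (liftKj c j) = size j"
  by (induct m and j arbitrary: c and c) simp_all

lemma adequate_all: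
  "(\<forall>m. size m < n \<longrightarrow> adequate m) \<and> (\<forall>j. size j < n \<longrightarrow> redsJ j (rj Var SV (trj VV KV j)))"
proof (induct n)
  case (Suc n)
  then have IH: "\<And>m. size m < n \<Longrightarrow> adequate m" "\<And>j. size j < n \<Longrightarrow> redsJ j (rj Var SV (trj VV KV j))"
    by auto
  have V0: "adequate (Var i)" for i by (rule adequate_val) simp_all
  have "adequate m" if "size m < Suc n" for m
  proof (cases m)
    case (Lam l)
    have "reds (body (plug (rk Var (SV 0 \<cdot> SV) (KV 0)) l)) (rm Var SV (tr VV (\<lambda>k. KV (Suc k)) l (KV 0)))"
      using Lam that by (intro adequateD IH) simp_all
    then have "reds m (rv Var SV (trv VV KV m))"
      using Lam by (simp only: trv_simps rv_VL upT_env) (simp add: reds_Lam)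
    then show ?thesis using Lam by (intro adequate_val) simp_all
  next
    case (App a b)
    have sz: "size a < n" "size b < n" using App that by auto
    \<comment> \<open>Naming a part makes an application larger, so the expanded term is beyond the
      induction hypothesis and its adequacy is assembled from its parts. The claim is general in
      \<open>v\<close> and \<open>b'\<close> because it is also applied to \<open>Var 0\<close> and
      the lifted operand.\<close>
    have val: "adequate (App v b')" if "is_val v" "size b' < n" "\<And>c. adequate (liftT c v)" "adequate v" for v b'
    proof (cases "is_val b'")
      case True
      then show ?thesis using that IH(1)[of b'] by (intro adequate_App_val)
    next
      case False
      then show ?thesis using that by (intro adequate_App_nv2) (auto intro: IH)
    qed
    show ?thesis
    proof (cases "is_val a")
      case True
      then show ?thesis unfolding App by (rule val) (use sz in \<open>auto intro: IH\<close>)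
    next
      case False
      have "adequate (App (Var 0) (liftT 0 b))"
        by (rule val) (use sz in \<open>auto intro: V0\<close>)
      with False show ?thesis unfolding App
        by (rule adequate_App_nv1) (use sz in \<open>auto intro: IH\<close>)
    qed
  next
    case (Wh a b)
    then show ?thesis using that by (simp, intro adequate_Wh) (auto intro: IH)
  next
    case (Mu j)
    then show ?thesis using that by (simp, intro adequate_Mu) (auto intro: IH)
  qed (simp add: V0)
  moreover have "redsJ j (rj Var SV (trj VV KV j))" if "size j < Suc n" for j
  proof (cases j)
    case (Jmp k m)
    then show ?thesis using adequateD(1)[OF IH(1)[of m], of "KV k"] that by simp
  next
    case (JWh i m)
    have "redsJ (JWh i m) (JWh (rj Var SV (trj VV KV i)) m)"
      using JWh that by (intro reds_JWh IH reds_refl) simp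
    also have "\<dots> = plug (rk Var SV (KL (trj VV KV i))) m" by (simp add: upT_env)
    also have "redsJ \<dots> (rj Var SV (tr VV KV m (KL (trj VV KV i))))"
      using JWh that by (intro adequateD IH) simp
    finally show ?thesis using JWh by simp
  qed
  ultimately show ?case by blast
qed simp

lemma reds_rm_tr: "reds m (rm Var SV (tr VV (\<lambda>k. KV (Suc k)) m (KV 0)))"
  using adequateD(2)[of m "KV 0"] adequate_all[of "Suc (size m)"] by simp

theorem theorem2p1:
  assumes "ccv_eq M1 M2"
  shows "\<exists>N. reds M1 N \<and> reds M2 N"
proof -
  let ?tr = "\<lambda>m. tr VV (\<lambda>k. KV (Suc k)) m (KV 0)"
  obtain q where "pQ\<^sup>*\<^sup>* (?tr M1) q" "pQ\<^sup>*\<^sup>* (?tr M2) q"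
    using pQ_join[OF ccv_eq_sound[OF assms]] by blast
  then show ?thesis using reds_trans[OF reds_rm_tr reds_rm_pQ] by blast
qed

end
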